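(* Let $\sigma>0$, $\alpha>0$, $\Lambda = \frac{1}{\sigma}\sqrt{\Gamma(3/\alpha)/\Gamma(1/\alpha)}$, and let $(X_i)_{i\ge1}$ be independent and identically distributed real random variables with $\mathbb{E}[X_i]=0$, $\mathbb{E}|X_i|<\infty$, and density $$f_{X_1}(z) = \frac{\alpha\Lambda^2}{\Gamma(1/\alpha)^2} K_0\!\left(2\Lambda^\alpha |z|^{\alpha/2}\right), \quad z\in\mathbb{R}.$$ Let $S_n = \sum_{i=1}^n X_i$. Then for every $n \ge 1$, $$\mathbb{E}|S_n| \ \ge\ \sqrt{n}\,\frac{\Gamma(2/\alpha)^2}{\Lambda^2\,\Gamma(1/\alpha)^2} \;=\; \sqrt{n}\,\frac{\sigma^2\,\Gamma(2/\alpha)^2}{\Gamma(1/\alpha)\,\Gamma(3/\alpha)}.$$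
   Context: $K_0$ is the modified Bessel function of the second kind of order $0$; $\Gamma$ is the Euler Gamma function. The given density is that of the product of two independent generalized normal variables with density $\frac{\alpha\Lambda}{2\Gamma(1/\alpha)} e^{-\Lambda^\alpha |x|^\alpha}$. *)

theory Defs
  imports "HOL-Probability.Probability"
begin

text \<open>Modified Bessel function of the second kind of order 0, via its standard
integral representation K_0(x) = int_0^infty exp(-x cosh t) dt  (x > 0).\<close>
definition bessel_K0 :: "real \<Rightarrow> real" where
  "bessel_K0 x = (LBINT t:{0..}. exp (- (x * cosh t)))"

end

theory Submission
  imports Defs
begin

text \<open>
  The inequality \<open>E |S\<^sub>n| \<ge> sqrt n E |X\<^sub>1|\<close> fails for general centred variables (for instance
  for signs), so the density has to be used. A generalized normal variable is a scale mixture of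
  uniform variables on \<open>[-1, 1]\<close>; hence \<open>X\<close> has the law of \<open>W T\<close> with \<open>W \<ge> 0\<close> independent of \<open>T\<close>,
  and \<open>T\<close> the product of two independent uniform variables on \<open>[-1, 1]\<close>. The characteristic
  function of \<open>T\<close> is \<open>\<psi> t = Si t / t\<close>, which is positive. The function \<open>- ln (\<psi> t) / t\<^sup>2\<close> is
  decreasing, whence \<open>\<Prod>\<^sub>i \<psi> (w\<^sub>i) \<le> \<psi> (sqrt (\<Sum>\<^sub>i w\<^sub>i\<^sup>2))\<close>. Inserting this into the formula
  \<open>c |x| = \<integral> (1 - cos (t x)) / t\<^sup>2 dt\<close> gives \<open>E |\<Sum>\<^sub>i w\<^sub>i T\<^sub>i| \<ge> sqrt (\<Sum>\<^sub>i w\<^sub>i\<^sup>2) E |T|\<close>, and by the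
  Cauchy-Schwarz inequality \<open>E sqrt (\<Sum>\<^sub>i W\<^sub>i\<^sup>2) \<ge> sqrt n E W\<close>.
\<close>

subsection \<open>The sine integral\<close>

text \<open>Maclaurin's remainder estimate; \<open>6227020800\<close> is \<open>13!\<close>. Degree
  11 leaves an error that is small enough for the later comparison on
  \<open>t^2 \<le> 20\<close>.\<close>

lemma sin_taylor_bounds:
  fixes x :: real
  shows "\<bar>sin x - (x - x^3/6 + x^5/120 - x^7/5040 + x^9/362880 - x^11/39916800)\<bar> \<le> \<bar>x\<bar>^13 / 6227020800"
proof -
  have range: "{..<13::nat} = {12,11,10,9,8,7,6,5,4,3,2,1,0}"
    by (simp add: lessThan_nat_numeral lessThan_Suc)
  have coeffs: "sin_coeff 0 = 0" "sin_coeff (Suc 0) = 1" "sin_coeff 2 = 0" "sin_coeff 3 = -1/6"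
    "sin_coeff 4 = 0" "sin_coeff 5 = 1/120" "sin_coeff 6 = 0" "sin_coeff 7 = -1/5040"
    "sin_coeff 8 = 0" "sin_coeff 9 = 1/362880" "sin_coeff 10 = 0"
    "sin_coeff 11 = -1/39916800" "sin_coeff 12 = 0"
    by (simp_all add: sin_coeff_def fact_numeral)
  have *: "(\<Sum>m<13. sin_coeff m * x ^ m) = x - x^3/6 + x^5/120 - x^7/5040 + x^9/362880 - x^11/39916800"
    unfolding range by (simp add: coeffs)
  have **: "inverse (fact 13) = (1 / 6227020800 :: real)"
    by (simp add: fact_numeral)
  show ?thesis
    using Maclaurin_sin_bound[of x 13] unfolding * ** by simp
qed

lemma Si_0 [simp]: "Si 0 = 0"
  by (simp add: Si_def zero_ereal_def)

lemma Si_le: assumes "0 \<le> t" shows "Si t \<le> t"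
proof -
  have "(\<lambda>x. x - Si x) 0 \<le> (\<lambda>x. x - Si x) t"
  proof (rule DERIV_nonneg_imp_nondecreasing[OF assms])
    fix u :: real assume "0 \<le> u"
    hence "0 \<le> 1 - sinc u" using sin_x_le_x[of u] by (simp add: field_simps)
    moreover have "((\<lambda>x. x - Si x) has_real_derivative 1 - sinc u) (at u)"
      by (intro DERIV_diff DERIV_ident DERIV_Si)
    ultimately show "\<exists>z. ((\<lambda>x. x - Si x) has_real_derivative z) (at u) \<and> 0 \<le> z" by blast
  qed
  thus ?thesis by simp
qed

text \<open>The sine bounds are divided by the variable and integrated from 0: up to sign, the
  coefficient of \<open>x^k\<close> becomes \<open>1 / (k * k!)\<close>, and the error becomes
  \<open>x^13 / (13 * 13!)\<close>. Each inequality compares derivatives of functions that agree at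
  0.\<close>

lemma Si_taylor_bounds:
  fixes x :: real
  assumes "0 \<le> x"
  defines "p \<equiv> \<lambda>x::real. x - x^3/18 + x^5/600 - x^7/35280 + x^9/3265920 - x^11/439084800"
  shows "Si x \<le> p x + x^13 / 80951270400" and "p x - x^13 / 80951270400 \<le> Si x"
proof -
  define p' where "p' = (\<lambda>x::real. 1 - x^2/6 + x^4/120 - x^6/5040 + x^8/362880 - x^10/39916800)"
  have sinc: "\<bar>sinc u - p' u\<bar> \<le> u^12 / 6227020800" if "0 \<le> u" for u
  proof (cases "u = 0")
    case False
    with that have u: "u > 0" by simp
    have "u * (sinc u - p' u) = sin u - (u - u^3/6 + u^5/120 - u^7/5040 + u^9/362880 - u^11/39916800)"
      using u by (simp add: p'_def algebra_simps power_numeral_reduce)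
    hence "\<bar>u * (sinc u - p' u)\<bar> \<le> \<bar>u\<bar>^13 / 6227020800"
      using sin_taylor_bounds[of u] by presburger
    hence "u * \<bar>sinc u - p' u\<bar> \<le> u^13 / 6227020800"
      using u by (simp only: abs_mult abs_of_pos)
    also have "\<dots> = u * (u^12 / 6227020800)" by (simp add: power_numeral_reduce)
    finally show ?thesis using u by (simp only: mult_le_cancel_left_pos)
  qed (simp add: p'_def)
  have dp: "(p has_real_derivative p' u) (at u)" for u
    unfolding p_def p'_def by (rule derivative_eq_intros refl | simp)+
  have dr: "((\<lambda>x. x^13 / 80951270400) has_real_derivative u^12 / 6227020800) (at u)" for u :: real
    by (rule derivative_eq_intros refl | simp)+
  have up: "((\<lambda>x. p x + x^13 / 80951270400 - Si x) has_real_derivative p' u + u^12 / 6227020800 - sinc u) (at u)"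
    and lo: "((\<lambda>x. Si x - (p x - x^13 / 80951270400)) has_real_derivative sinc u - (p' u - u^12 / 6227020800)) (at u)" for u
    by (intro DERIV_add DERIV_diff dp dr DERIV_Si)+
  have "(\<lambda>x. p x + x^13 / 80951270400 - Si x) 0 \<le> (\<lambda>x. p x + x^13 / 80951270400 - Si x) x"
  proof (rule DERIV_nonneg_imp_nondecreasing[OF assms(1)])
    fix u :: real assume "0 \<le> u"
    from sinc[OF this] have "0 \<le> p' u + u^12 / 6227020800 - sinc u" by linarith
    with up show "\<exists>y. ((\<lambda>x. p x + x^13 / 80951270400 - Si x) has_real_derivative y) (at u) \<and> 0 \<le> y"
      by blast
  qed
  then show "Si x \<le> p x + x^13 / 80951270400" by (simp add: p_def)
  have "(\<lambda>x. Si x - (p x - x^13 / 80951270400)) 0 \<le> (\<lambda>x. Si x - (p x - x^13 / 80951270400)) x"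
  proof (rule DERIV_nonneg_imp_nondecreasing[OF assms(1)])
    fix u :: real assume "0 \<le> u"
    from sinc[OF this] have "0 \<le> sinc u - (p' u - u^12 / 6227020800)" by linarith
    with lo show "\<exists>y. ((\<lambda>x. Si x - (p x - x^13 / 80951270400)) has_real_derivative y) (at u) \<and> 0 \<le> y"
      by blast
  qed
  then show "p x - x^13 / 80951270400 \<le> Si x" by (simp add: p_def)
qed

text \<open>Two integrations by parts suggest the correction \<open>F\<close>, whose derivative is
  dominated by that of \<open>1 / x^2\<close>. So \<open>F - 1 / x^2\<close> increases and
  \<open>F + 1 / x^2\<close> decreases, both towards \<open>pi / 2\<close>. Hence \<open>F t\<close>
  is within \<open>1 / t^2\<close> of the limit, and the two added terms of \<open>F\<close> account
  for the rest of the bound.\<close>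

lemma Si_asymptotic_bounds:
  fixes t :: real
  assumes "0 < t"
  shows "\<bar>Si t - pi / 2\<bar> \<le> 1 / t + 2 / t^2"
proof -
  define F where "F = (\<lambda>x. Si x + cos x / x + sin x / x^2)"
  have dF: "(F has_real_derivative - 2 * sin x / x^3) (at x)" if "x > 0" for x
    unfolding F_def using that
    by (auto intro!: derivative_eq_intros DERIV_Si simp: field_simps power_numeral_reduce)
  have dG: "((\<lambda>x. 1 / x^2) has_real_derivative - 2 / x^3) (at x)" if "x > 0" for x :: real
    using that by (auto intro!: derivative_eq_intros simp: field_simps power_numeral_reduce)
  have lim: "(F \<longlongrightarrow> pi/2) at_top"
  proof -
    have "((\<lambda>x::real. cos x / x) \<longlongrightarrow> 0) at_top"
      by (rule Lim_null_comparison[where g="\<lambda>x. 1/x"])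
         (auto intro!: eventually_mono[OF eventually_gt_at_top[of 0]] tendsto_divide_0[OF tendsto_const] filterlim_at_top_imp_at_infinity filterlim_ident simp: divide_right_mono)
    moreover have "((\<lambda>x::real. sin x / x^2) \<longlongrightarrow> 0) at_top"
      by (rule Lim_null_comparison[where g="\<lambda>x. 1/x^2"])
         (auto intro!: eventually_mono[OF eventually_gt_at_top[of 0]] tendsto_divide_0[OF tendsto_const] filterlim_at_top_imp_at_infinity filterlim_pow_at_top filterlim_ident simp: divide_right_mono)
    ultimately have "((\<lambda>x. Si x + cos x / x + sin x / x^2) \<longlongrightarrow> pi/2 + 0 + 0) at_top"
      by (intro tendsto_add Si_at_top)
    thus ?thesis by (simp add: F_def)
  qed
  have limG: "((\<lambda>x::real. 1 / x^2) \<longlongrightarrow> 0) at_top"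
    by (auto intro!: tendsto_divide_0[OF tendsto_const] filterlim_at_top_imp_at_infinity filterlim_pow_at_top filterlim_ident)
  have up: "F t - 1 / t^2 \<le> pi / 2"
  proof (rule tendsto_lowerbound[where F=at_top and f="\<lambda>x. F x - 1 / x^2"])
    show "((\<lambda>x. F x - 1 / x^2) \<longlongrightarrow> pi/2) at_top" using tendsto_diff[OF lim limG] by simp
    show "\<forall>\<^sub>F x in at_top. F t - 1 / t^2 \<le> F x - 1 / x^2"
      using eventually_ge_at_top[of t]
    proof eventually_elim
      case (elim x)
      show ?case
      proof (rule DERIV_nonneg_imp_nondecreasing[OF elim])
        fix y assume "t \<le> y"
        then have y: "y > 0" using assms by simp
        show "\<exists>z. ((\<lambda>x. F x - 1 / x^2) has_real_derivative z) (at y) \<and> 0 \<le> z"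
          by (rule exI, rule conjI, rule derivative_intros, rule dF[OF y], rule dG[OF y])
             (use y sin_le_one[of y] in \<open>simp add: field_simps\<close>)
      qed
    qed
  qed simp
  have lo: "pi / 2 \<le> F t + 1 / t^2"
  proof (rule tendsto_upperbound[where F=at_top and f="\<lambda>x. F x + 1 / x^2"])
    show "((\<lambda>x. F x + 1 / x^2) \<longlongrightarrow> pi/2) at_top" using tendsto_add[OF lim limG] by simp
    show "\<forall>\<^sub>F x in at_top. F x + 1 / x^2 \<le> F t + 1 / t^2"
      using eventually_ge_at_top[of t]
    proof eventually_elim
      case (elim x)
      show ?case
      proof (rule DERIV_nonpos_imp_nonincreasing[OF elim])
        fix y assume "t \<le> y"
        then have y: "y > 0" using assms by simp
        show "\<exists>z. ((\<lambda>x. F x + 1 / x^2) has_real_derivative z) (at y) \<and> z \<le> 0"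
          by (rule exI, rule conjI, rule derivative_intros, rule dF[OF y], rule dG[OF y])
             (use y sin_ge_minus_one[of y] in \<open>simp add: field_simps\<close>)
      qed
    qed
  qed simp
  have "\<bar>cos t / t\<bar> \<le> 1 / t" using assms by (simp add: divide_right_mono)
  moreover have "\<bar>sin t / t^2\<bar> \<le> 1 / t^2" using assms by (simp add: divide_right_mono)
  moreover have "2 / t^2 = 1 / t^2 + 1 / t^2" by simp
  ultimately show ?thesis using up lo unfolding F_def by linarith
qed


section \<open>The logarithmic inequality behind the monotonicity of
  \<open>- ln (psi t) / t^2\<close>\<close>

lemma neg_ln_one_minus_ge:
  fixes d :: real
  assumes "0 \<le> d" "d < 1"
  shows "d + d^2 / 2 + d^3 / 3 \<le> - ln (1 - d)"
proof -
  let ?f = "\<lambda>u::real. - ln (1 - u) - (u + u^2 / 2 + u^3 / 3)"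
  have "?f 0 \<le> ?f d"
  proof (rule DERIV_nonneg_imp_nondecreasing[OF assms(1)])
    fix u assume u: "0 \<le> u" "u \<le> d"
    have "(?f has_real_derivative (1 / (1 - u) - (1 + u + u^2))) (at u)"
      using u assms by (auto intro!: derivative_eq_intros simp: field_simps)
    moreover have "1 / (1 - u) - (1 + u + u^2) = u^3 / (1 - u)"
      using u assms by (simp add: field_simps power_numeral_reduce)
    ultimately show "\<exists>y. (?f has_real_derivative y) (at u) \<and> 0 \<le> y"
      using u assms by auto
  qed
  thus ?thesis by simp
qed

text \<open>Put \<open>y = t\<^sup>2 / 20\<close>, \<open>d = 1 - Si t / t\<close> and \<open>e = 1 - sin t / t\<close>. Truncating the series of
  \<open>- ln (1 - d)\<close> reduces \<open>1 - sin t / Si t \<le> 2 ln (t / Si t)\<close> to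
  \<open>d\<^sup>2 + d\<^sup>3 / 3 + 2 d\<^sup>4 / 3 \<le> 3 d - e\<close>. By Taylor expansion \<open>y q\<close> bounds \<open>d\<close> from above, and the right-hand side
  below, times \<open>y\<^sup>2\<close>, bounds \<open>3 d - e\<close> from below. The polynomials in the proof are positive on the
  unit interval because their Bernstein coefficients are.\<close>
lemma log_Si_polynomial_inequality:
  fixes y :: real
  assumes "0 \<le> y" "y \<le> 1"
  defines "q \<equiv> 28/25 - 16/25 * y + 4/25 * y^2"
  shows "q^2 + y * q^3 / 3 + 2 * y^2 * q^4 / 3 \<le> 1333/1000 - 908/1000*y + 293/1000*y^2 - 59/1000*y^3 - 13/1000*y^4"
proof -
  define z where "z = 1 - y"
  have z: "0 \<le> z" "1 = y + z" using assms by (auto simp: z_def)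
  have q: "q = 4/25 * (3 + (2 - y)^2)" by (simp add: q_def power2_eq_square algebra_simps)
  \<comment> \<open>Bounding the cofactor of \<open>y\<close> by the constant \<open>27/50\<close>
    lowers the left-hand side of the goal from degree 10 to degree 5. The sum is the Bernstein form
    of the gap, homogeneous in \<open>y\<close> and \<open>z = 1 - y\<close>.\<close>
  have "0 \<le> 1/6 * z^5 + 263/1250 * y * z^4 + 29/375 * y^2 * z^3 + 233/1875 * y^3 * z^2 + 121/750 * y^4 * z + 67/1250 * y^5"
    using assms z by (intro add_nonneg_nonneg mult_nonneg_nonneg) auto
  also have "\<dots> = 27/50 - q / 3 - 2 * y * q^2 / 3"
    unfolding z_def q_def by algebra
  finally have 1: "q / 3 + 2 * y * q^2 / 3 \<le> 27/50" by simp
  have "q^2 + y * q^3 / 3 + 2 * y^2 * q^4 / 3 = q^2 * (1 + y * (q / 3 + 2 * y * q^2 / 3))"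
    by algebra
  also have "\<dots> \<le> q^2 * (1 + y * (27/50))"
    by (rule mult_left_mono[OF add_left_mono[OF mult_left_mono[OF 1 assms(1)]] zero_le_power2])
  also have "\<dots> \<le> 1333/1000 - 908/1000*y + 293/1000*y^2 - 59/1000*y^3 - 13/1000*y^4"
  proof -
    have "0 \<le> 393/5000 * z^5 + 30153/125000 * y * z^4 + 11951/25000 * y^2 * z^3 + 31491/62500 * y^3 * z^2 + 5437/25000 * y^4 * z + 951/62500 * y^5"
      using assms z by (intro add_nonneg_nonneg mult_nonneg_nonneg) auto
    also have "\<dots> = 1333/1000 - 908/1000*y + 293/1000*y^2 - 59/1000*y^3 - 13/1000*y^4 - q^2 * (1 + y * (27/50))"
      unfolding z_def q_def by algebra
    finally show ?thesis by simp
  qed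
  finally show ?thesis .
qed

text \<open>Taking sixth powers reduces this to a rational comparison with \<open>e < 2.72\<close>.
  It settles the one range of large \<open>t\<close> where \<open>t / Si t\<close> may stay below
  \<open>e\<close>.\<close>

lemma exp_five_sixths_le: "exp (5/6 :: real) \<le> 235 / 100"
proof -
  have "exp (5/6 :: real) ^ 6 = exp 1 ^ 5"
    by (simp flip: exp_of_nat_mult)
  also have "\<dots> \<le> (272/100) ^ 5"
    using e_less_272 by (intro power_mono) auto
  also have "\<dots> \<le> (235 / 100 :: real) ^ 6" by (simp add: power_divide)
  finally show ?thesis using power_mono_iff[of "exp (5/6)" "235/100 :: real" 6] by simp
qed

text \<open>Together with the case \<open>20 \<le> t^2\<close> this gives the sign of the derivative
  of \<open>ln (t / Si t) / t^2\<close>. On the present range Taylor polynomials are precise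
  enough.\<close>

lemma Si_log_inequality_small:
  fixes t :: real
  assumes "0 < t" "t^2 \<le> 20"
  shows "0 < Si t" "1 - sin t / Si t \<le> 2 * ln (t / Si t)"
proof -
  define y where "y = t^2 / 20"
  define q where "q = 28/25 - 16/25 * y + 4/25 * y^2"
  define d where "d = 1 - Si t / t"
  define e where "e = 1 - sin t / t"
  have y: "0 \<le> y" "y \<le> 1" using assms by (auto simp: y_def)
  have Si: "Si t = t * (1 - d)" and sin: "sin t = t * (1 - e)"
    using assms by (auto simp: d_def e_def)
  have t_pow: "t^3 = t * (20 * y)" "t^5 = t * (20 * y)^2" "t^7 = t * (20 * y)^3" "t^9 = t * (20 * y)^4"
    "t^11 = t * (20 * y)^5" "t^13 = t * (20 * y)^6"
    by (simp_all add: y_def flip: power_mult power_Suc)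
  \<comment> \<open>The substitution \<open>t^2 = 20 * y\<close> multiplies the Taylor coefficients
    by powers of 20, for instance \<open>20/18 = 10/9\<close>; the last term is the error
    bound.\<close>
  have "t * d \<le> t * (y * (10/9 - 2/3 * y + 100/441 * y^2 - 250/5103 * y^3 + 500/68607 * y^4 + 2500/3162159 * y^5))"
    using Si_taylor_bounds(2)[of t] assms(1) unfolding Si t_pow by (simp add: field_simps power_numeral_reduce)
  hence d_le: "d \<le> y * (10/9 - 2/3 * y + 100/441 * y^2 - 250/5103 * y^3 + 500/68607 * y^4 + 2500/3162159 * y^5)"
    using assms(1) by (simp only: mult_le_cancel_left_pos)
  \<comment> \<open>The terms of order \<open>t^2\<close> in \<open>3 * d\<close> and
    \<open>e\<close> cancel, since \<open>3/18 = 1/6\<close>; this leaves the factor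
    \<open>y^2\<close>. The last coefficient collects the errors of both expansions.\<close>
  have "t * (y^2 * (4/3 - 400/441 * y + 500/1701 * y^2 - 4000/68607 * y^3 - 40000/3162159 * y^4)) \<le> t * (3 * d - e)"
    using Si_taylor_bounds(1)[of t] sin_taylor_bounds[of t] assms(1) unfolding abs_of_pos[OF assms(1)] Si sin t_pow abs_le_iff
    by (simp add: field_simps power_numeral_reduce)
  hence de: "y^2 * (4/3 - 400/441 * y + 500/1701 * y^2 - 4000/68607 * y^3 - 40000/3162159 * y^4) \<le> 3 * d - e"
    using assms(1) by (simp only: mult_le_cancel_left_pos)
  have "10/9 - 2/3 * y + 100/441 * y^2 - 250/5103 * y^3 + 500/68607 * y^4 + 2500/3162159 * y^5 \<le> q"
  proof -
    \<comment> \<open>Powers above the third are absorbed into \<open>y^3\<close>, and the remaining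
      cubic is positive by its Bernstein coefficients.\<close>
    have "y^4 \<le> y^3" "y^5 \<le> y^3" using y by (auto intro!: power_decreasing)
    moreover have "0 \<le> 2/225 * (1 - y)^3 + 4/75 * (y * (1 - y)^2) + 1319/100000 * (y^2 * (1 - y)) + 7871/900000 * y^3"
      using y by simp
    moreover have "2/225 * (1 - y)^3 + 4/75 * (y * (1 - y)^2) + 1319/100000 * (y^2 * (1 - y)) + 7871/900000 * y^3
        = 2/225 + 2/75 * y - 6681/100000 * y^2 + 1/25 * y^3"
      by algebra
    ultimately show ?thesis unfolding q_def using y zero_le_power[OF y(1), of 3] zero_le_power2[of y] by linarith
  qed
  with d_le y have d_le_q: "d \<le> y * q" by (meson mult_left_mono order_trans)
  \<comment> \<open>The Taylor coefficients are rounded downwards to three decimals.\<close>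
  have "y^2 * (1333/1000 - 908/1000*y + 293/1000*y^2 - 59/1000*y^3 - 13/1000*y^4) \<le>
    y^2 * (4/3 - 400/441 * y + 500/1701 * y^2 - 4000/68607 * y^3 - 40000/3162159 * y^4)"
  proof (rule mult_left_mono)
    have "0 \<le> y^2" "0 \<le> y^3" "0 \<le> y^4" using y by auto
    thus "1333/1000 - 908/1000*y + 293/1000*y^2 - 59/1000*y^3 - 13/1000*y^4 \<le> 4/3 - 400/441 * y + 500/1701 * y^2 - 4000/68607 * y^3 - 40000/3162159 * y^4"
      using y by linarith
  qed simp
  with de have e_le: "y^2 * (1333/1000 - 908/1000*y + 293/1000*y^2 - 59/1000*y^3 - 13/1000*y^4) \<le> 3 * d - e"
    by linarith
  have d0: "0 \<le> d" using Si_le[of t] assms by (simp add: d_def)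
  have d1: "d < 1"
  proof -
    have "y^2 \<le> y" using y by (simp add: power2_eq_square mult_left_le)
    hence "q \<le> 28/25 - 12/25 * y" by (simp add: q_def)
    hence "y * q \<le> y * (28/25 - 12/25 * y)" using y by (intro mult_left_mono)
    also have "\<dots> = 16/25 - (1 - y) * (16/25 - 12/25 * y)" by (simp add: field_simps power2_eq_square)
    also have "\<dots> \<le> 16/25" using y by simp
    finally show ?thesis using d_le_q by simp
  qed
  show "0 < Si t" using d1 assms by (simp add: Si)
  have "d^2 + d^3 / 3 + 2 * d^4 / 3 \<le> (y * q)^2 + (y * q)^3 / 3 + 2 * (y * q)^4 / 3"
    using d_le_q d0 by (intro add_mono divide_right_mono mult_left_mono power_mono) auto
  also have "\<dots> = y^2 * (q^2 + y * q^3 / 3 + 2 * y^2 * q^4 / 3)"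
    by (simp add: field_simps power_numeral_reduce)
  also have "\<dots> \<le> y^2 * (1333/1000 - 908/1000*y + 293/1000*y^2 - 59/1000*y^3 - 13/1000*y^4)"
    unfolding q_def by (intro mult_left_mono log_Si_polynomial_inequality y) auto
  also note e_le
  finally have "d^2 + d^3 / 3 + 2 * d^4 / 3 \<le> 3 * d - e" .
  \<comment> \<open>Since \<open>sin t / Si t = (1 - e) / (1 - d)\<close>, multiplying by
    \<open>1 - d\<close> clears the denominator and makes the inequality polynomial.\<close>
  moreover have "(2 * d + d^2 + 2 * d^3 / 3 - 1) * (1 - d) = 3 * d - d^2 - d^3 / 3 - 2 * d^4 / 3 - 1"
    by (simp add: field_simps power_numeral_reduce)
  ultimately have "(1 - (2 * d + d^2 + 2 * d^3 / 3)) * (1 - d) \<le> 1 - e" by (simp add: algebra_simps)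
  hence "1 - (2 * d + d^2 + 2 * d^3 / 3) \<le> (1 - e) / (1 - d)" using d1 by (simp add: pos_le_divide_eq)
  moreover have "sin t / Si t = (1 - e) / (1 - d)" using assms by (simp add: Si sin)
  moreover have "ln (t / Si t) = - ln (1 - d)" using assms d1 by (simp add: Si ln_div ln_mult)
  ultimately show "1 - sin t / Si t \<le> 2 * ln (t / Si t)"
    using neg_ln_one_minus_ge[OF d0 d1] by simp
qed

text \<open>Here \<open>Si t\<close> is close to \<open>pi / 2\<close>, and the left-hand side is at
  most \<open>1 + 1 / Si t < 2\<close>. This suffices unless \<open>t / Si t < e\<close>.\<close>

lemma Si_log_inequality_large:
  fixes t :: real
  assumes "0 < t" "20 \<le> t^2"
  shows "0 < Si t" "1 - sin t / Si t \<le> 2 * ln (t / Si t)"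
proof -
  have t: "447/100 \<le> t"
    by (rule power2_le_imp_le) (use assms in \<open>auto simp: power2_eq_square\<close>)
  have "1 / t \<le> 100/447" using t by (simp add: field_simps)
  moreover have "2 / t^2 \<le> 1/10" using assms by (simp add: field_simps)
  ultimately have "\<bar>Si t - pi / 2\<bar> \<le> 324/1000"
    using Si_asymptotic_bounds[OF assms(1)] by linarith
  moreover have pi_less: "pi < 315/100" using pi_approx by simp
  ultimately have s: "1 < Si t" "Si t \<le> 19/10"
    using pi_gt3 pi_less by linarith+
  show "0 < Si t" using s by simp
  have "\<bar>sin t / Si t\<bar> \<le> 1 / Si t" using s by (simp add: divide_right_mono)
  hence sin: "- sin t / Si t \<le> 1 / Si t" unfolding abs_le_iff by simp
  show "1 - sin t / Si t \<le> 2 * ln (t / Si t)"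
  proof (cases "exp 1 \<le> t / Si t")
    case True
    hence "1 \<le> ln (t / Si t)" using s t by (subst ln_ge_iff) auto
    moreover have "1 / Si t \<le> 1" using s by simp
    ultimately show ?thesis using sin by linarith
  next
    case False
    \<comment> \<open>As \<open>t\<close> is at least 4.47, \<open>Si t\<close> must then be at
      least 3/2, so the left-hand side is at most 5/3. The bound \<open>Si t \<le> 1.9\<close> makes
      the logarithm at least 5/6.\<close>
    hence "t < exp 1 * Si t" using s by (simp add: field_simps)
    also have "\<dots> \<le> 272/100 * Si t" using s e_less_272 by (intro mult_right_mono) auto
    finally have "3/2 \<le> Si t" using t by simp
    hence "1 / Si t \<le> 2/3" by (simp add: field_simps)
    moreover have "235/100 \<le> t / Si t"
      using s t by (simp add: pos_le_divide_eq)
    hence "exp (5/6) \<le> t / Si t" using exp_five_sixths_le by linarith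
    hence "5/6 \<le> ln (t / Si t)" using s t by (subst ln_ge_iff) auto
    ultimately show ?thesis using sin by linarith
  qed
qed

text \<open>The characteristic function of the product of two independent variables that are uniform
  on the unit interval and carry independent random signs.\<close>
definition psi :: "real \<Rightarrow> real" where
  "psi t = (if t = 0 then 1 else Si t / t)"

lemma Si_pos: "0 < t \<Longrightarrow> 0 < Si t"
  using Si_log_inequality_small(1) Si_log_inequality_large(1) by (cases "t^2 \<le> 20") auto

lemma psi_pos: "0 \<le> t \<Longrightarrow> 0 < psi t"
  by (simp add: psi_def Si_pos)

text \<open>The numerator of the derivative of \<open>ln (t / Si t) / t^2\<close> is exactly the
  difference controlled by the logarithmic inequality.\<close>

lemma neg_ln_psi_over_square_antimono:
  assumes "0 < a" "a \<le> b"
  shows "- ln (psi b) / b^2 \<le> - ln (psi a) / a^2"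
proof -
  let ?G = "\<lambda>t. ln (t / Si t) / t^2"
  have "?G b \<le> ?G a"
  proof (rule DERIV_nonpos_imp_nonincreasing[OF assms(2)])
    fix t assume "a \<le> t"
    hence t: "0 < t" and S: "0 < Si t" using assms Si_pos by auto
    have D: "(Si has_real_derivative sin t / t) (at t)" using DERIV_Si[of t] t by simp
    have "(?G has_real_derivative (1 - sin t / Si t - 2 * ln (t / Si t)) / t^3) (at t)"
      using t S by (auto intro!: derivative_eq_intros D simp: field_simps power_numeral_reduce)
    moreover have "1 - sin t / Si t \<le> 2 * ln (t / Si t)"
      using Si_log_inequality_small(2) Si_log_inequality_large(2) t by (cases "t^2 \<le> 20") auto
    ultimately show "\<exists>y. (?G has_real_derivative y) (at t) \<and> y \<le> 0"
      using t by (intro exI[of _ "(1 - sin t / Si t - 2 * ln (t / Si t)) / t^3"]) (auto intro!: divide_nonpos_pos)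
  qed
  moreover have "- ln (psi t) = ln (t / Si t)" if "0 < t" for t
    using that Si_pos[OF that] by (simp add: psi_def ln_div)
  ultimately show ?thesis using assms by simp
qed

lemma psi_mult_le:
  assumes "0 \<le> a" "0 \<le> b"
  shows "psi a * psi b \<le> psi (sqrt (a^2 + b^2))"
proof (cases "a = 0 \<or> b = 0")
  case True
  thus ?thesis using assms by (auto simp: psi_def)
next
  case False
  hence ab: "0 < a" "0 < b" using assms by auto
  let ?c = "sqrt (a^2 + b^2)"
  have c: "a \<le> ?c" "b \<le> ?c" "0 < ?c" using ab by (auto intro!: real_le_rsqrt simp: sum_power2_gt_zero_iff)
  \<comment> \<open>Monotonicity compares the quotients at \<open>a\<close> and at \<open>b\<close>
    with the one at \<open>?c\<close>. Weighted by \<open>a^2\<close> and \<open>b^2\<close>, the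
    two comparisons add up, because \<open>a^2 + b^2 = ?c^2\<close>.\<close>
  define G where "G = - ln (psi ?c) / ?c^2"
  have "a^2 * G \<le> - ln (psi a)" "b^2 * G \<le> - ln (psi b)"
    using neg_ln_psi_over_square_antimono[OF ab(1) c(1)] neg_ln_psi_over_square_antimono[OF ab(2) c(2)] ab
    unfolding G_def by (simp_all add: field_simps)
  hence "ln (psi a) + ln (psi b) \<le> - ((a^2 + b^2) * G)" by (simp add: algebra_simps)
  also have "\<dots> = ln (psi ?c)" using ab by (simp add: G_def sum_power2_eq_zero_iff)
  finally have "ln (psi a * psi b) \<le> ln (psi ?c)" using ab psi_pos[of a] psi_pos[of b] by (subst ln_mult_pos) auto
  thus ?thesis
    using psi_pos[of a] psi_pos[of b] psi_pos[of ?c] ab c(3)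
    by (subst (asm) ln_le_cancel_iff) auto
qed

lemma prod_psi_le:
  assumes "finite I" "\<And>i. i \<in> I \<Longrightarrow> 0 \<le> w i"
  shows "(\<Prod>i\<in>I. psi (w i)) \<le> psi (sqrt (\<Sum>i\<in>I. (w i)^2))"
  using assms
proof (induction I rule: finite_induct)
  case (insert j I)
  have "(\<Prod>i\<in>insert j I. psi (w i)) \<le> psi (w j) * psi (sqrt (\<Sum>i\<in>I. (w i)^2))"
    using insert psi_pos[of "w j"] by (simp add: mult_left_mono)
  also have "\<dots> \<le> psi (sqrt ((w j)^2 + (sqrt (\<Sum>i\<in>I. (w i)^2))^2))"
    using insert by (intro psi_mult_le) (auto intro!: sum_nonneg)
  finally show ?case using insert by (simp add: sum_nonneg)
qed (simp add: psi_def)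

subsection \<open>Absolute moments by Fourier transform\<close>

lemma psi_le_1: "0 \<le> t \<Longrightarrow> psi t \<le> 1"
  using Si_le[of t] by (simp add: psi_def)

lemma borel_measurable_psi [measurable]: "psi \<in> borel_measurable borel"
  unfolding psi_def[abs_def] by measurable

text \<open>The value is \<open>pi / 2\<close>, but only positivity and finiteness matter, as the constant cancels.\<close>
definition abs_fourier_const :: ennreal where
  "abs_fourier_const = (\<integral>\<^sup>+t. ennreal ((1 - cos t) / t^2) * indicator {0<..} t \<partial>lborel)"

text \<open>The substitution of \<open>\<bar>x\<bar> * t\<close> for \<open>t\<close> extracts the
  factor: \<open>x^2\<close> comes from the denominator, and the Jacobian removes one power of
  \<open>\<bar>x\<bar>\<close>.\<close>

lemma nn_integral_one_minus_cos:
  "(\<integral>\<^sup>+t. ennreal ((1 - cos (t * x)) / t^2) * indicator {0<..} t \<partial>lborel) = abs_fourier_const * ennreal \<bar>x\<bar>"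
proof (cases "x = 0")
  case False
  let ?f = "\<lambda>t::real. ennreal ((1 - cos t) / t^2) * indicator {0<..} t"
  \<comment> \<open>The summand 0 gives the argument the shape expected by the affine substitution
    rule.\<close>
  have "(\<integral>\<^sup>+t. ennreal ((1 - cos (t * x)) / t^2) * indicator {0<..} t \<partial>lborel)
      = (\<integral>\<^sup>+t. ennreal (x^2) * ?f (0 + \<bar>x\<bar> * t) \<partial>lborel)"
  proof (rule nn_integral_cong)
    fix t :: real
    show "ennreal ((1 - cos (t * x)) / t^2) * indicator {0<..} t = ennreal (x^2) * ?f (0 + \<bar>x\<bar> * t)"
      using False
      by (cases "0 < t") (auto simp: indicator_def zero_less_mult_iff abs_if power_mult_distrib mult.commute simp flip: ennreal_mult')
  qed
  also have "\<dots> = ennreal (x^2) * (\<integral>\<^sup>+t. ?f (0 + \<bar>x\<bar> * t) \<partial>lborel)"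
    by (intro nn_integral_cmult) measurable
  also have "\<dots> = ennreal \<bar>x\<bar> * (ennreal \<bar>x\<bar> * (\<integral>\<^sup>+t. ?f (0 + \<bar>x\<bar> * t) \<partial>lborel))"
    by (simp add: power2_eq_square flip: mult.assoc ennreal_mult')
  also have "ennreal \<bar>x\<bar> * (\<integral>\<^sup>+t. ?f (0 + \<bar>x\<bar> * t) \<partial>lborel) = abs_fourier_const"
    unfolding abs_fourier_const_def using False by (subst (2) nn_integral_real_affine[where c="\<bar>x\<bar>" and t=0]) auto
  finally show ?thesis by (simp add: mult.commute)
qed simp

text \<open>Both \<open>1 - cos t \<le> t^2 / 2\<close> and \<open>1 - cos t \<le> 2\<close> are
  used: the first near 0, the second at infinity. Together they give the integrable bound
  \<open>4 / (1 + t^2)\<close>.\<close>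

lemma abs_fourier_const_finite: "abs_fourier_const < \<top>"
proof -
  have "integrable lborel (\<lambda>t. indicator {0<..} t *\<^sub>R (1 / (1 + t^2) :: real))"
    using integrable_I0i_1_div_plus_square
    by (simp add: interval_lebesgue_integral_0_infty set_integrable_def)
  hence fin: "(\<integral>\<^sup>+t. ennreal (norm (indicator {0<..} t *\<^sub>R (1 / (1 + t^2) :: real))) \<partial>lborel) < \<infinity>"
    by (simp add: integrable_iff_bounded)
  have "abs_fourier_const \<le> (\<integral>\<^sup>+t. ennreal 4 * ennreal (norm (indicator {0<..} t *\<^sub>R (1 / (1 + t^2) :: real))) \<partial>lborel)"
    unfolding abs_fourier_const_def
  proof (rule nn_integral_mono)
    fix t :: real
    have "(1 - cos t) / t^2 \<le> 4 / (1 + t^2)" if "0 < t"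
    proof -
      have "cos t = 1 - 2 * (sin (t/2))^2" using cos_double_sin[of "t/2"] by simp
      moreover have "(sin (t/2))^2 \<le> (t/2)^2"
        using abs_sin_x_le_abs_x[of "t/2"] by (simp only: abs_le_square_iff)
      ultimately have "1 - cos t \<le> t^2 / 2" by (simp add: power_divide)
      moreover have "(1 - cos t) * t^2 \<le> 2 * t^2" by (intro mult_right_mono) auto
      ultimately have "(1 - cos t) * (1 + t^2) \<le> 4 * t^2"
        unfolding distrib_left mult_1_right using zero_le_power2[of t] by linarith
      thus ?thesis using that by (simp add: divide_simps add_pos_nonneg)
    qed
    moreover have "ennreal (4 / (1 + t^2)) = ennreal 4 * ennreal (1 / (1 + t^2))"
      by (subst ennreal_mult[symmetric]) auto
    ultimately have "ennreal ((1 - cos t) / t^2) \<le> ennreal 4 * ennreal (1 / (1 + t^2))" if "0 < t"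
      using that by (metis ennreal_leI)
    thus "ennreal ((1 - cos t) / t^2) * indicator {0<..} t
        \<le> ennreal 4 * ennreal (norm (indicator {0<..} t *\<^sub>R (1 / (1 + t^2) :: real)))"
      by (auto simp: indicator_def simp del: ennreal_numeral)
  qed
  also have "\<dots> = ennreal 4 * (\<integral>\<^sup>+t. ennreal (norm (indicator {0<..} t *\<^sub>R (1 / (1 + t^2) :: real))) \<partial>lborel)"
    by (intro nn_integral_cmult) measurable
  also have "\<dots> < \<top>" using fin by (simp add: ennreal_mult_less_top)
  finally show ?thesis .
qed

text \<open>On the interval from \<open>pi / 2\<close> to \<open>pi\<close> the cosine is
  nonpositive, so the integrand is at least \<open>1 / pi^2\<close>.\<close>

lemma abs_fourier_const_pos: "0 < abs_fourier_const"
proof -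
  have "0 < ennreal (1 / pi^2) * ennreal (pi / 2)"
    by (simp flip: ennreal_mult')
  also have "\<dots> = (\<integral>\<^sup>+t. ennreal (1 / pi^2) * indicator {pi/2..pi} t \<partial>lborel)"
    by (simp add: nn_integral_cmult_indicator)
  also have "\<dots> \<le> abs_fourier_const"
    unfolding abs_fourier_const_def
  proof (rule nn_integral_mono)
    fix t :: real
    have "1 / pi^2 \<le> (1 - cos t) / t^2" if t: "pi/2 \<le> t" "t \<le> pi"
    proof -
      have "0 \<le> sin (t - pi/2)" using t by (intro sin_ge_zero) auto
      hence "cos t \<le> 0" by (simp add: sin_diff)
      thus ?thesis using t pi_gt_zero by (intro frac_le power_mono) auto
    qed
    moreover have "0 < t" if "pi/2 \<le> t" using that pi_gt_zero by linarith
    ultimately show "ennreal (1 / pi^2) * indicator {pi/2..pi} t \<le> ennreal ((1 - cos t) / t^2) * indicator {0<..} t"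
      by (auto simp: indicator_def intro!: ennreal_leI)
  qed
  finally show ?thesis .
qed

text \<open>Integrating over \<open>v\<close> gives \<open>1 - sinc (t * u)\<close>, and integrating
  that over \<open>u\<close> gives the sine integral. The random signs disappear because cosine is
  even; passing to \<open>1 - psi\<close> keeps integrands nonnegative, so that Tonelli's theorem
  applies later.\<close>

lemma one_minus_psi_eq_nn_integral:
  assumes "0 \<le> t"
  shows "ennreal (1 - psi t) = (\<integral>\<^sup>+u. (\<integral>\<^sup>+v. ennreal (1 - cos (t * u * v)) * indicator {0..1} v \<partial>lborel) * indicator {0..1} u \<partial>lborel)"
proof (cases "t = 0")
  case False
  with assms have t: "0 < t" by simp
  have inner: "(\<integral>\<^sup>+v. ennreal (1 - cos (s * v)) * indicator {0..1} v \<partial>lborel) = ennreal (1 - sinc s)" for s :: real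
  proof (cases "s = 0")
    case False
    have "(\<integral>\<^sup>+v. ennreal (1 - cos (s * v)) * indicator {0..1} v \<partial>lborel) = ennreal ((1 - sin (s * 1) / s) - (0 - sin (s * 0) / s))"
      using False by (intro nn_integral_FTC_Icc) (auto intro!: derivative_eq_intros)
    thus ?thesis using False by simp
  qed simp
  have D: "((\<lambda>u. u - Si (t * u) / t) has_real_derivative 1 - sinc (t * u)) (at u)" for u
  proof -
    have "((\<lambda>u. Si (t * u)) has_real_derivative sinc (t * u) * t) (at u)"
      by (rule DERIV_chain2[OF DERIV_Si]) (auto intro!: derivative_eq_intros)
    from DERIV_diff[OF DERIV_ident DERIV_cdivide[OF this, of t]] show ?thesis using t by simp
  qed
  have nonneg: "0 \<le> 1 - sinc (t * u)" if "0 \<le> u" for u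
    using sin_x_le_x[of "t * u"] that t by (auto simp: field_simps)
  have meas: "(\<lambda>u. 1 - sinc (t * u)) \<in> borel_measurable borel" by measurable
  have "(\<integral>\<^sup>+u. ennreal (1 - sinc (t * u)) * indicator {0..1} u \<partial>lborel) = ennreal ((1 - Si (t * 1) / t) - (0 - Si (t * 0) / t))"
    by (rule nn_integral_FTC_Icc[where F="\<lambda>u. u - Si (t * u) / t", OF meas D nonneg]) auto
  thus ?thesis unfolding inner using t by (simp add: psi_def)
qed (simp add: psi_def)

text \<open>The formula for absolute values is applied to \<open>r * u * v\<close> and averaged over
  the unit square; \<open>1 / 4\<close> is the mean of \<open>u * v\<close>.\<close>

lemma nn_integral_one_minus_psi:
  assumes "0 \<le> r"
  shows "(\<integral>\<^sup>+t. ennreal ((1 - psi (t * r)) / t^2) * indicator {0<..} t \<partial>lborel) = abs_fourier_const * ennreal (r / 4)"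
proof -
  let ?S = "{0..1} \<times> {0..1} :: (real \<times> real) set"
  interpret L: pair_sigma_finite "lborel \<Otimes>\<^sub>M lborel :: (real \<times> real) measure" "lborel :: real measure"
    unfolding lborel_prod by unfold_locales
  have psi: "ennreal (1 - psi t) = (\<integral>\<^sup>+p. ennreal (1 - cos (t * fst p * snd p)) * indicator ?S p \<partial>(lborel \<Otimes>\<^sub>M lborel))" if "0 \<le> t" for t
    unfolding one_minus_psi_eq_nn_integral[OF that]
    by (subst lborel.nn_integral_fst[symmetric])
       (auto intro!: nn_integral_cong simp: indicator_times nn_integral_multc[symmetric] mult_ac split: split_indicator)
  have "(\<integral>\<^sup>+t. ennreal ((1 - psi (t * r)) / t^2) * indicator {0<..} t \<partial>lborel)
      = (\<integral>\<^sup>+t. (\<integral>\<^sup>+p. ennreal ((1 - cos (t * (r * fst p * snd p))) / t^2) * indicator {0<..} t * indicator ?S p \<partial>(lborel \<Otimes>\<^sub>M lborel)) \<partial>lborel)"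
  proof (rule nn_integral_cong)
    fix t :: real
    show "ennreal ((1 - psi (t * r)) / t^2) * indicator {0<..} t
      = (\<integral>\<^sup>+p. ennreal ((1 - cos (t * (r * fst p * snd p))) / t^2) * indicator {0<..} t * indicator ?S p \<partial>(lborel \<Otimes>\<^sub>M lborel))"
    proof (cases "0 < t")
      case True
      have "ennreal ((1 - psi (t * r)) / t^2) = ennreal (1 / t^2) * ennreal (1 - psi (t * r))"
        by (simp flip: ennreal_mult')
      also have "\<dots> = (\<integral>\<^sup>+p. ennreal (1 / t^2) * (ennreal (1 - cos (t * r * fst p * snd p)) * indicator ?S p) \<partial>(lborel \<Otimes>\<^sub>M lborel))"
        using True assms by (subst psi) (auto intro!: nn_integral_cmult[symmetric])
      also have "\<dots> = (\<integral>\<^sup>+p. ennreal ((1 - cos (t * (r * fst p * snd p))) / t^2) * indicator ?S p \<partial>(lborel \<Otimes>\<^sub>M lborel))"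
        by (intro nn_integral_cong) (simp add: mult.assoc[symmetric] flip: ennreal_mult')
      finally show ?thesis using True by simp
    qed simp
  qed
  also have "\<dots> = (\<integral>\<^sup>+p. (\<integral>\<^sup>+t. ennreal ((1 - cos (t * (r * fst p * snd p))) / t^2) * indicator {0<..} t * indicator ?S p \<partial>lborel) \<partial>(lborel \<Otimes>\<^sub>M lborel))"
    by (intro L.Fubini') measurable
  also have "\<dots> = (\<integral>\<^sup>+p. abs_fourier_const * (ennreal (r * fst p * snd p) * indicator ?S p) \<partial>(lborel \<Otimes>\<^sub>M lborel))"
  proof (rule nn_integral_cong)
    fix p :: "real \<times> real"
    have "(\<integral>\<^sup>+t. ennreal ((1 - cos (t * (r * fst p * snd p))) / t^2) * indicator {0<..} t * indicator ?S p \<partial>lborel) = abs_fourier_const * ennreal \<bar>r * fst p * snd p\<bar> * indicator ?S p"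
      by (subst nn_integral_multc) (auto simp: nn_integral_one_minus_cos)
    thus "(\<integral>\<^sup>+t. ennreal ((1 - cos (t * (r * fst p * snd p))) / t^2) * indicator {0<..} t * indicator ?S p \<partial>lborel) = abs_fourier_const * (ennreal (r * fst p * snd p) * indicator ?S p)"
      using assms by (auto simp: indicator_def abs_mult mult.assoc)
  qed
  also have "\<dots> = abs_fourier_const * (\<integral>\<^sup>+p. ennreal (r * fst p * snd p) * indicator ?S p \<partial>(lborel \<Otimes>\<^sub>M lborel))"
    by (intro nn_integral_cmult) measurable
  also have "(\<integral>\<^sup>+p. ennreal (r * fst p * snd p) * indicator ?S p \<partial>(lborel \<Otimes>\<^sub>M lborel))
      = (\<integral>\<^sup>+u. (\<integral>\<^sup>+v. ennreal (r * u * v) * indicator {0..1} v \<partial>lborel) * indicator {0..1} u \<partial>lborel)"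
    by (subst lborel.nn_integral_fst[symmetric])
       (auto intro!: nn_integral_cong simp: indicator_times nn_integral_multc[symmetric] mult_ac split: split_indicator)
  also have "\<dots> = (\<integral>\<^sup>+u. ennreal (r * u / 2) * indicator {0..1} u \<partial>lborel)"
  proof (rule nn_integral_cong)
    fix u :: real
    have "(\<integral>\<^sup>+v. ennreal (r * u * v) * indicator {0..1} v \<partial>lborel) = ennreal (r * u * 1^2 / 2 - r * u * 0^2 / 2)" if "0 \<le> u"
      using that assms by (intro nn_integral_FTC_Icc) (auto intro!: derivative_eq_intros)
    thus "(\<integral>\<^sup>+v. ennreal (r * u * v) * indicator {0..1} v \<partial>lborel) * indicator {0..1} u = ennreal (r * u / 2) * indicator {0..1} u"
      by (auto simp: indicator_def)
  qed
  also have "\<dots> = ennreal (r * 1^2 / 4 - r * 0^2 / 4)"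
    using assms by (intro nn_integral_FTC_Icc) (auto intro!: derivative_eq_intros)
  finally show ?thesis by simp
qed

lemma (in prob_space) nn_integral_one_minus_expectation_cos:
  assumes "integrable M X"
  shows "(\<integral>\<^sup>+t. ennreal ((1 - expectation (\<lambda>\<omega>. cos (t * X \<omega>))) / t^2) * indicator {0<..} t \<partial>lborel)
    = abs_fourier_const * ennreal (expectation (\<lambda>\<omega>. \<bar>X \<omega>\<bar>))"
proof -
  have [measurable]: "X \<in> borel_measurable M" using assms by simp
  interpret L: pair_sigma_finite M "lborel :: real measure" by unfold_locales
  have "abs_fourier_const * ennreal (expectation (\<lambda>\<omega>. \<bar>X \<omega>\<bar>)) = abs_fourier_const * (\<integral>\<^sup>+\<omega>. ennreal \<bar>X \<omega>\<bar> \<partial>M)"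
    using assms by (subst nn_integral_eq_integral) auto
  also have "\<dots> = (\<integral>\<^sup>+\<omega>. (\<integral>\<^sup>+t. ennreal ((1 - cos (t * X \<omega>)) / t^2) * indicator {0<..} t \<partial>lborel) \<partial>M)"
    by (simp add: nn_integral_one_minus_cos nn_integral_cmult)
  also have "\<dots> = (\<integral>\<^sup>+t. (\<integral>\<^sup>+\<omega>. ennreal ((1 - cos (t * X \<omega>)) / t^2) * indicator {0<..} t \<partial>M) \<partial>lborel)"
    by (intro L.Fubini'[symmetric]) measurable
  also have "\<dots> = (\<integral>\<^sup>+t. ennreal ((1 - expectation (\<lambda>\<omega>. cos (t * X \<omega>))) / t^2) * indicator {0<..} t \<partial>lborel)"
  proof (rule nn_integral_cong)
    fix t :: real
    have int: "integrable M (\<lambda>\<omega>. cos (t * X \<omega>))"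
      by (rule integrable_const_bound[where B=1]) auto
    have "(\<integral>\<^sup>+\<omega>. ennreal ((1 - cos (t * X \<omega>)) / t^2) \<partial>M) = ennreal (expectation (\<lambda>\<omega>. (1 - cos (t * X \<omega>)) / t^2))"
      using int by (intro nn_integral_eq_integral) auto
    also have "expectation (\<lambda>\<omega>. (1 - cos (t * X \<omega>)) / t^2) = (1 - expectation (\<lambda>\<omega>. cos (t * X \<omega>))) / t^2"
      using int by (simp add: prob_space)
    finally show "(\<integral>\<^sup>+\<omega>. ennreal ((1 - cos (t * X \<omega>)) / t^2) * indicator {0<..} t \<partial>M)
        = ennreal ((1 - expectation (\<lambda>\<omega>. cos (t * X \<omega>))) / t^2) * indicator {0<..} t"
      by (simp add: nn_integral_multc)
  qed
  finally show ?thesis ..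
qed

section \<open>Sums of independent scale mixtures\<close>

lemma sum_le_sqrt_card_mult_sqrt_sum_squares:
  fixes w :: "'i \<Rightarrow> real"
  shows "(\<Sum>i\<in>I. w i) \<le> sqrt (card I) * sqrt (\<Sum>i\<in>I. (w i)^2)"
proof -
  have "(\<Sum>i\<in>I. 1 * w i)^2 \<le> (\<Sum>i\<in>I. 1^2) * (\<Sum>i\<in>I. (w i)^2)"
    by (rule Cauchy_Schwarz_ineq_sum)
  hence "(\<Sum>i\<in>I. w i)^2 \<le> card I * (\<Sum>i\<in>I. (w i)^2)" by simp
  thus ?thesis unfolding real_sqrt_mult[symmetric] by (rule real_le_rsqrt)
qed

text \<open>The mixture enters only through characteristic functions, so no representation of
  \<open>X i\<close> as a product is constructed on \<open>M\<close>. The factor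
  \<open>1 / 4\<close> is the absolute mean of the variable with characteristic function
  \<open>psi\<close>.\<close>

lemma expectation_abs_sum_mixture_ge:
  fixes X :: "nat \<Rightarrow> 'a \<Rightarrow> real" and w :: "'b \<Rightarrow> real"
  assumes M: "prob_space M" and P: "prob_space P"
    and indep: "prob_space.indep_vars M (\<lambda>_. borel) X I" and I: "finite I" "I \<noteq> {}"
    and X: "\<And>i. i \<in> I \<Longrightarrow> integrable M (X i)"
    and w: "integrable P w" "\<And>p. 0 \<le> w p"
    and char: "\<And>i t. i \<in> I \<Longrightarrow> 0 < t \<Longrightarrow>
      char (distr M borel (X i)) t = complex_of_real (\<integral>p. psi (t * w p) \<partial>P)"
  shows "sqrt (card I) / 4 * (\<integral>p. w p \<partial>P) \<le> (\<integral>\<omega>. \<bar>\<Sum>i\<in>I. X i \<omega>\<bar> \<partial>M)"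
proof -
  interpret M: prob_space M by fact
  interpret P: prob_space P by fact
  have [measurable]: "w \<in> borel_measurable P" using w by simp
  have [measurable]: "X i \<in> borel_measurable M" if "i \<in> I" for i using X[OF that] by simp
  define S where "S = (\<lambda>\<omega>. \<Sum>i\<in>I. X i \<omega>)"
  have S: "integrable M S" unfolding S_def by (intro Bochner_Integration.integrable_sum X)
  hence [measurable]: "S \<in> borel_measurable M" by simp
  define \<phi> where "\<phi> t = (\<integral>p. psi (t * w p) \<partial>P)" for t
  \<comment> \<open>Under \<open>Q\<close> the values \<open>w (x i)\<close> are independent copies
    of the scale, and \<open>R\<close> below is their Euclidean norm.\<close>
  define Q where "Q = PiM I (\<lambda>_. P)"
  interpret PP: product_prob_space "\<lambda>_. P" I by unfold_locales
  interpret Q: prob_space Q unfolding Q_def by (rule prob_space_PiM) (rule P)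
  have [measurable]: "(\<lambda>x. w (x i)) \<in> borel_measurable Q" if "i \<in> I" for i
    unfolding Q_def using that by measurable
  define R where "R x = sqrt (\<Sum>i\<in>I. (w (x i))^2)" for x
  have R: "R \<in> borel_measurable Q" unfolding R_def[abs_def] by measurable
  note R[measurable]
  have R0: "0 \<le> R x" for x unfolding R_def by (simp add: sum_nonneg)
  have psi_bounds: "0 < psi (t * r)" "psi (t * r) \<le> 1" if "0 < t" "0 \<le> r" for t r
    using psi_pos[of "t * r"] psi_le_1[of "t * r"] that by auto

  have cos_S: "M.expectation (\<lambda>\<omega>. cos (t * S \<omega>)) = \<phi> t ^ card I" if "0 < t" for t
  proof -
    have "char (distr M borel S) t = complex_of_real (\<phi> t ^ card I)"
      unfolding S_def M.char_distr_sum[OF indep] using that by (simp add: char \<phi>_def)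
    moreover have "char (distr M borel S) t = (CLINT \<omega>|M. iexp (t * S \<omega>))"
      unfolding char_def by (simp add: integral_distr)
    moreover have "Re (CLINT \<omega>|M. iexp (t * S \<omega>)) = M.expectation (\<lambda>\<omega>. Re (iexp (t * S \<omega>)))"
      by (rule integral_Re[symmetric]) (rule M.integrable_iexp, measurable)
    moreover have "(\<lambda>\<omega>. Re (iexp (t * S \<omega>))) = (\<lambda>\<omega>. cos (t * S \<omega>))"
      unfolding cis_conv_exp[symmetric] by simp
    ultimately show ?thesis by (metis Re_complex_of_real)
  qed
  \<comment> \<open>A power of a mean is the mean of a product over the product space, where the
    pointwise bound on products of \<open>psi\<close> applies.\<close>
  have phi_power: "\<phi> t ^ card I \<le> (\<integral>x. psi (t * R x) \<partial>Q)" if "0 < t" for t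
  proof -
    have int: "integrable P (\<lambda>p. psi (t * w p))"
      using psi_bounds[OF that] w(2) by (intro P.integrable_const_bound[where B=1]) (auto simp: abs_of_pos)
    have "\<phi> t ^ card I = (\<Prod>i\<in>I. \<integral>p. psi (t * w p) \<partial>P)" by (simp add: \<phi>_def)
    also have "\<dots> = (\<integral>x. (\<Prod>i\<in>I. psi (t * w (x i))) \<partial>Q)"
      unfolding Q_def by (rule PP.product_integral_prod[symmetric]) (use I int in auto)
    also have "\<dots> \<le> (\<integral>x. psi (t * R x) \<partial>Q)"
    proof (rule integral_mono)
      show "integrable Q (\<lambda>x. \<Prod>i\<in>I. psi (t * w (x i)))"
        unfolding Q_def by (rule PP.product_integrable_prod) (use I int in auto)
      show "integrable Q (\<lambda>x. psi (t * R x))"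
        using psi_bounds[OF that] R0 by (intro Q.integrable_const_bound[where B=1]) (auto simp: abs_of_pos)
      fix x
      have "(\<Prod>i\<in>I. psi (t * w (x i))) \<le> psi (sqrt (\<Sum>i\<in>I. (t * w (x i))^2))"
        using that w I by (intro prod_psi_le) auto
      also have "sqrt (\<Sum>i\<in>I. (t * w (x i))^2) = t * R x"
        using that by (simp add: R_def power_mult_distrib real_sqrt_mult flip: sum_distrib_left)
      finally show "(\<Prod>i\<in>I. psi (t * w (x i))) \<le> psi (t * R x)" .
    qed
    finally show ?thesis .
  qed

  interpret L: pair_sigma_finite Q "lborel :: real measure" by unfold_locales
  have w_comp: "integrable Q (\<lambda>x. w (x i)) \<and> (\<integral>x. w (x i) \<partial>Q) = (\<integral>p. w p \<partial>P)" if "i \<in> I" for i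
  proof -
    have *: "distr Q P (\<lambda>x. x i) = P" unfolding Q_def by (rule PP.PiM_component[OF that])
    have [measurable]: "(\<lambda>x. x i) \<in> measurable Q P" unfolding Q_def using that by measurable
    have "integrable (distr Q P (\<lambda>x. x i)) w" using w by (simp add: *)
    moreover have "(\<integral>p. w p \<partial>distr Q P (\<lambda>x. x i)) = (\<integral>x. w (x i) \<partial>Q)" by (simp add: integral_distr)
    ultimately show ?thesis using integrable_distr_eq[of "\<lambda>x. x i" Q P w] by (simp add: *)
  qed
  \<comment> \<open>The chain starts from the smaller side: Cauchy-Schwarz passes to the mean of
    \<open>R / 4\<close>, which is expanded as a Fourier integral and compared for each
    \<open>t\<close> with that of \<open>S\<close>.\<close>
  have "abs_fourier_const * ennreal (sqrt (card I) / 4 * (\<integral>p. w p \<partial>P)) = abs_fourier_const * ennreal (\<integral>x. (\<Sum>i\<in>I. w (x i)) / sqrt (card I) / 4 \<partial>Q)"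
  proof -
    have "(\<integral>x. (\<Sum>i\<in>I. w (x i)) / sqrt (card I) / 4 \<partial>Q) = card I * (\<integral>p. w p \<partial>P) / sqrt (card I) / 4"
      using w_comp by (simp add: Bochner_Integration.integral_sum)
    also have "\<dots> = sqrt (card I) / 4 * (\<integral>p. w p \<partial>P)"
      using real_div_sqrt[of "card I"] by (metis mult.commute of_nat_0_le_iff times_divide_eq_left times_divide_eq_right)
    finally show ?thesis by (simp only:)
  qed
  also have "\<dots> = abs_fourier_const * (\<integral>\<^sup>+x. ennreal ((\<Sum>i\<in>I. w (x i)) / sqrt (card I) / 4) \<partial>Q)"
    using w_comp w(2) by (subst nn_integral_eq_integral) (auto intro!: sum_nonneg divide_nonneg_nonneg)
  also have "\<dots> \<le> abs_fourier_const * (\<integral>\<^sup>+x. ennreal (R x / 4) \<partial>Q)"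
  proof (intro mult_left_mono nn_integral_mono ennreal_leI divide_right_mono)
    fix x
    show "(\<Sum>i\<in>I. w (x i)) / sqrt (card I) \<le> R x"
      using sum_le_sqrt_card_mult_sqrt_sum_squares[of "\<lambda>i. w (x i)" I] I
      by (simp add: R_def divide_le_eq card_gt_0_iff mult.commute)
  qed auto
  also have "\<dots> = (\<integral>\<^sup>+x. (\<integral>\<^sup>+t. ennreal ((1 - psi (t * R x)) / t^2) * indicator {0<..} t \<partial>lborel) \<partial>Q)"
    by (simp add: nn_integral_one_minus_psi R0 nn_integral_cmult)
  also have "\<dots> = (\<integral>\<^sup>+t. (\<integral>\<^sup>+x. ennreal ((1 - psi (t * R x)) / t^2) * indicator {0<..} t \<partial>Q) \<partial>lborel)"
    by (intro L.Fubini'[symmetric]) measurable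
  also have "\<dots> \<le> (\<integral>\<^sup>+t. ennreal ((1 - M.expectation (\<lambda>\<omega>. cos (t * S \<omega>))) / t^2) * indicator {0<..} t \<partial>lborel)"
  proof (rule nn_integral_mono)
    fix t :: real
    show "(\<integral>\<^sup>+x. ennreal ((1 - psi (t * R x)) / t^2) * indicator {0<..} t \<partial>Q)
      \<le> ennreal ((1 - M.expectation (\<lambda>\<omega>. cos (t * S \<omega>))) / t^2) * indicator {0<..} t"
    proof (cases "0 < t")
      case True
      have int: "integrable Q (\<lambda>x. psi (t * R x))"
        using psi_bounds[OF True] R0 by (intro Q.integrable_const_bound[where B=1]) (auto simp: abs_of_pos)
      have "(\<integral>\<^sup>+x. ennreal ((1 - psi (t * R x)) / t^2) \<partial>Q) = ennreal (\<integral>x. (1 - psi (t * R x)) / t^2 \<partial>Q)"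
        using int psi_bounds[OF True] R0 by (intro nn_integral_eq_integral) auto
      also have "(\<integral>x. (1 - psi (t * R x)) / t^2 \<partial>Q) = (1 - (\<integral>x. psi (t * R x) \<partial>Q)) / t^2"
        using int by (simp add: Q.prob_space)
      also have "\<dots> \<le> (1 - M.expectation (\<lambda>\<omega>. cos (t * S \<omega>))) / t^2"
        unfolding cos_S[OF True] using phi_power[OF True] by (intro divide_right_mono) auto
      finally show ?thesis using True by (simp add: ennreal_leI)
    qed simp
  qed
  also have "\<dots> = abs_fourier_const * ennreal (M.expectation (\<lambda>\<omega>. \<bar>S \<omega>\<bar>))"
    by (rule M.nn_integral_one_minus_expectation_cos[OF S])
  finally have "ennreal (sqrt (card I) / 4 * (\<integral>p. w p \<partial>P)) \<le> ennreal (M.expectation (\<lambda>\<omega>. \<bar>S \<omega>\<bar>))"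
    using abs_fourier_const_pos abs_fourier_const_finite by (subst (asm) ennreal_mult_le_mult_iff) auto
  thus ?thesis by (simp add: S_def)
qed

subsection \<open>The Bessel density as a mixture\<close>

lemma nn_integral_even:
  fixes g :: "real \<Rightarrow> ennreal"
  assumes [measurable]: "g \<in> borel_measurable borel" and even: "\<And>x. g (- x) = g x"
  shows "(\<integral>\<^sup>+x. g x \<partial>lborel) = 2 * (\<integral>\<^sup>+x. g x * indicator {0<..} x \<partial>lborel)"
proof -
  have "(\<integral>\<^sup>+x. g x \<partial>lborel) = (\<integral>\<^sup>+x. g x * indicator {0<..} x + g x * indicator {..<0} x \<partial>lborel)"
    using AE_lborel_singleton[of 0] by (intro nn_integral_cong_AE) (auto simp: indicator_def)
  also have "\<dots> = (\<integral>\<^sup>+x. g x * indicator {0<..} x \<partial>lborel) + (\<integral>\<^sup>+x. g x * indicator {..<0} x \<partial>lborel)"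
    by (intro nn_integral_add) measurable
  also have "(\<integral>\<^sup>+x. g x * indicator {..<0} x \<partial>lborel) = (\<integral>\<^sup>+x. g x * indicator {0<..} x \<partial>lborel)"
    by (subst nn_integral_real_affine[where c="-1" and t=0]) (auto simp: even indicator_def intro!: nn_integral_cong)
  finally show ?thesis by (simp add: mult_2)
qed

lemma nn_integral_exp_neg_atLeast:
  "(\<integral>\<^sup>+s. ennreal (exp (- s)) * indicator {x..} s \<partial>lborel) = ennreal (exp (- x))"
proof -
  have lim: "((\<lambda>s::real. - exp (- s)) \<longlongrightarrow> 0) at_top"
    using tendsto_minus[OF filterlim_compose[OF exp_at_bot filterlim_uminus_at_bot_at_top]] by simp
  have "(\<integral>\<^sup>+s. ennreal (exp (- s)) * indicator {x..} s \<partial>lborel) = ennreal (0 - (- exp (- x)))"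
    by (rule nn_integral_FTC_atLeast[OF _ _ _ lim]) (auto intro!: derivative_eq_intros)
  thus ?thesis by simp
qed

text \<open>Gives the exponential majorant of the integrand of \<open>bessel_K0\<close>. The proof
  squares \<open>1 + t / 2 \<le> exp (t / 2)\<close>.\<close>

lemma cosh_ge_self: "t \<le> cosh (t::real)"
proof -
  have "2 * t \<le> exp t"
  proof (cases "0 \<le> t")
    case True
    have "2 * t \<le> (1 + t / 2)^2" using zero_le_power2[of "1 - t / 2"] by (simp add: power2_eq_square algebra_simps)
    also have "\<dots> \<le> exp (t / 2)^2" using exp_ge_add_one_self[of "t / 2"] True by (intro power_mono) auto
    also have "\<dots> = exp t" by (simp flip: exp_double)
    finally show ?thesis .
  next
    case False
    thus ?thesis using exp_gt_zero[of t] by linarith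
  qed
  hence "2 * t \<le> exp t + exp (- t)" by (rule order_trans) simp
  thus ?thesis unfolding cosh_field_def by simp
qed

lemma bessel_K0_nonneg: "0 \<le> bessel_K0 x"
  unfolding bessel_K0_def set_lebesgue_integral_def by (intro integral_nonneg_AE) auto

text \<open>Integrability is the point here: the Bochner integral in the definition would be 0 for a
  non-integrable function. The endpoint 0 is a null set.\<close>

lemma ennreal_bessel_K0:
  assumes "0 < x"
  shows "ennreal (bessel_K0 x) = (\<integral>\<^sup>+t. ennreal (exp (- (x * cosh t))) * indicator {0<..} t \<partial>lborel)"
proof -
  have "integrable lborel (\<lambda>t. indicator {0<..} t *\<^sub>R exp (- (t * x)))"
    using integrable_I0i_exp_mscale[OF assms] by (simp add: set_integrable_def)
  hence "integrable lborel (\<lambda>t. indicator {0..} t *\<^sub>R exp (- (x * cosh t)))"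
  proof (rule Bochner_Integration.integrable_bound)
    show "AE t in lborel. norm (indicator {0..} t *\<^sub>R exp (- (x * cosh t))) \<le> norm (indicator {0<..} t *\<^sub>R exp (- (t * x)))"
      using AE_lborel_singleton[of 0] assms cosh_ge_self by (auto simp: indicator_def mult.commute)
  qed (simp add: cosh_field_def)
  hence "ennreal (bessel_K0 x) = (\<integral>\<^sup>+t. ennreal (indicator {0..} t *\<^sub>R exp (- (x * cosh t))) \<partial>lborel)"
    unfolding bessel_K0_def set_lebesgue_integral_def by (subst nn_integral_eq_integral) auto
  also have "\<dots> = (\<integral>\<^sup>+t. ennreal (exp (- (x * cosh t))) * indicator {0<..} t \<partial>lborel)"
    using AE_lborel_singleton[of 0] by (intro nn_integral_cong_AE) (auto simp: indicator_def)
  finally show ?thesis .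
qed

text \<open>Writing \<open>exp (- 2 a cosh u) = exp (- a e\<^sup>u) exp (- a e\<^sup>-\<^sup>u)\<close> and each factor as an exponential tail,
  the integration over \<open>u\<close> yields the length of an interval, which is the logarithm below
  (\<open>ennreal\<close> truncates it at 0).\<close>
lemma bessel_K0_mixture:
  assumes "0 < q"
  shows "2 * ennreal (bessel_K0 (2 * sqrt q)) =
    (\<integral>\<^sup>+p. ennreal (exp (- (fst p + snd p))) * ennreal (ln (fst p * snd p / q)) * indicator ({0<..} \<times> {0<..}) p
      \<partial>(lborel \<Otimes>\<^sub>M lborel))"
proof -
  define a where "a = sqrt q"
  have a: "0 < a" "a * a = q" using assms by (auto simp: a_def)
  let ?g = "\<lambda>u. ennreal (exp (- (2 * a * cosh u)))"
  let ?J = "\<lambda>u p. indicator {a * exp u..} (fst p) * indicator {a * exp (- u)..} (snd p) :: ennreal"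
  let ?e = "\<lambda>p::real \<times> real. ennreal (exp (- (fst p + snd p)))"
  interpret L: pair_sigma_finite "lborel \<Otimes>\<^sub>M lborel :: (real \<times> real) measure" "lborel :: real measure"
    unfolding lborel_prod by unfold_locales
  have "2 * ennreal (bessel_K0 (2 * a)) = (\<integral>\<^sup>+u. ?g u \<partial>lborel)"
    using a(1) by (subst nn_integral_even) (auto simp: ennreal_bessel_K0 cosh_field_def)
  also have "\<dots> = (\<integral>\<^sup>+u. (\<integral>\<^sup>+p. ?e p * ?J u p \<partial>(lborel \<Otimes>\<^sub>M lborel)) \<partial>lborel)"
  proof (rule nn_integral_cong)
    fix u
    have "(\<integral>\<^sup>+p. ?e p * ?J u p \<partial>(lborel \<Otimes>\<^sub>M lborel))
      = (\<integral>\<^sup>+s. (\<integral>\<^sup>+r. (ennreal (exp (- s)) * indicator {a * exp u..} s) * (ennreal (exp (- r)) * indicator {a * exp (- u)..} r) \<partial>lborel) \<partial>lborel)"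
      by (subst lborel.nn_integral_fst[symmetric])
         (auto intro!: nn_integral_cong simp: exp_add exp_diff exp_minus ennreal_mult' mult_ac divide_inverse)
    also have "\<dots> = ennreal (exp (- (a * exp u))) * ennreal (exp (- (a * exp (- u))))"
      by (simp add: nn_integral_cmult nn_integral_multc nn_integral_exp_neg_atLeast)
    also have "\<dots> = ?g u"
      by (simp add: cosh_field_def algebra_simps flip: ennreal_mult' exp_add)
    finally show "?g u = (\<integral>\<^sup>+p. ?e p * ?J u p \<partial>(lborel \<Otimes>\<^sub>M lborel))" ..
  qed
  also have "\<dots> = (\<integral>\<^sup>+p. (\<integral>\<^sup>+u. ?e p * ?J u p \<partial>lborel) \<partial>(lborel \<Otimes>\<^sub>M lborel))"
    \<comment> \<open>Written out as inequalities, the indicators are recognized as jointly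
      measurable in \<open>u\<close> and \<open>p\<close>.\<close>
    unfolding atLeast_def indicator_def mem_Collect_eq by (intro L.Fubini') measurable
  also have "\<dots> = (\<integral>\<^sup>+p. ?e p * ennreal (ln (fst p * snd p / q)) * indicator ({0<..} \<times> {0<..}) p \<partial>(lborel \<Otimes>\<^sub>M lborel))"
  proof (rule nn_integral_cong)
    fix p :: "real \<times> real"
    obtain s r where p: "p = (s, r)" by (cases p)
    show "(\<integral>\<^sup>+u. ?e p * ?J u p \<partial>lborel) = ?e p * ennreal (ln (fst p * snd p / q)) * indicator ({0<..} \<times> {0<..}) p"
    proof (cases "0 < s \<and> 0 < r")
      case True
      \<comment> \<open>The two tail conditions bound \<open>u\<close> from above and from
        below.\<close>
      have "?J u p = indicator {ln (a / r)..ln (s / a)} u" for u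
      proof -
        have "a * exp u \<le> s \<longleftrightarrow> u \<le> ln (s / a)"
          using True a by (subst ln_ge_iff) (auto simp: field_simps)
        moreover have "a * exp (- u) \<le> r \<longleftrightarrow> ln (a / r) \<le> u"
        proof -
          have "a * exp (- u) \<le> r \<longleftrightarrow> a / r \<le> exp u" using True a by (simp add: field_simps exp_minus)
          thus ?thesis using True a ln_le_cancel_iff[of "a / r" "exp u"] by simp
        qed
        ultimately show ?thesis by (auto simp: p indicator_def)
      qed
      hence "(\<integral>\<^sup>+u. ?e p * ?J u p \<partial>lborel) = ?e p * emeasure lborel {ln (a / r)..ln (s / a)}"
        by (simp add: nn_integral_cmult_indicator)
      also have "emeasure lborel {ln (a / r)..ln (s / a)} = ennreal (ln (s / a) - ln (a / r))"
        by (auto simp: emeasure_lborel_Icc_eq ennreal_neg)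
      also have "ln (s / a) - ln (a / r) = ln (s * r / q)"
        using True a by (simp add: ln_div ln_mult flip: a(2))
      finally show ?thesis using True by (simp add: p)
    next
      case False
      have J0: "?J u p = 0" for u
      proof -
        have "0 < a * exp u" "0 < a * exp (- u)" using a by simp_all
        thus ?thesis using False by (auto simp: p indicator_def simp del: zero_less_mult_iff)
      qed
      show ?thesis using False by (simp only: J0) (auto simp: p)
    qed
  qed
  finally show ?thesis unfolding a_def .
qed

text \<open>The product of two independent uniform variables, scaled by \<open>w\<close>, has density
  \<open>ln (w / z) / w\<close> on the interval from 0 to \<open>w\<close>.\<close>
lemma one_minus_psi_log_density:
  assumes "0 \<le> t" "0 < w"
  shows "ennreal w * ennreal (1 - psi (t * w)) =
    (\<integral>\<^sup>+z. ennreal (1 - cos (t * z)) * ennreal (ln (w / z)) * indicator {0<..} z \<partial>lborel)"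
proof -
  let ?h = "\<lambda>z. ennreal (1 - cos (t * z))"
  \<comment> \<open>For fixed positive \<open>u\<close> this is the substitution
    \<open>z = w * u * v\<close>, with the Jacobian \<open>w * u\<close> balanced by
    \<open>1 / u\<close>; for negative \<open>u\<close> both sides vanish.\<close>
  have inner: "ennreal w * ((\<integral>\<^sup>+v. ennreal (1 - cos (t * w * u * v)) * indicator {0..1} v \<partial>lborel) * indicator {0..1} u)
      = (\<integral>\<^sup>+z. ?h z * (ennreal (1 / u) * indicator {0<..1} u * indicator {0..w * u} z) \<partial>lborel)" if "u \<noteq> 0" for u
  proof (cases "0 < u")
    case True
    have "(\<integral>\<^sup>+z. ?h z * indicator {0..w * u} z \<partial>lborel) = ennreal (w * u) * (\<integral>\<^sup>+v. ?h (w * u * v) * indicator {0..w * u} (w * u * v) \<partial>lborel)"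
      using True assms by (subst nn_integral_real_affine[where c="w * u" and t=0]) auto
    also have "(\<integral>\<^sup>+v. ?h (w * u * v) * indicator {0..w * u} (w * u * v) \<partial>lborel)
        = (\<integral>\<^sup>+v. ennreal (1 - cos (t * w * u * v)) * indicator {0..1} v \<partial>lborel)"
    proof (rule nn_integral_cong)
      fix v
      have wu: "0 < w * u" using True assms by simp
      have "w * u * v \<in> {0..w * u} \<longleftrightarrow> v \<in> {0..1}"
        using mult_le_cancel_left_pos[OF wu, of v 1] mult_le_cancel_left_pos[OF wu, of 0 v] by simp
      thus "?h (w * u * v) * indicator {0..w * u} (w * u * v) = ennreal (1 - cos (t * w * u * v)) * indicator {0..1} v"
        by (simp add: indicator_def mult.assoc)
    qed
    finally have *: "(\<integral>\<^sup>+z. ?h z * indicator {0..w * u} z \<partial>lborel) = ennreal (w * u) * (\<integral>\<^sup>+v. ennreal (1 - cos (t * w * u * v)) * indicator {0..1} v \<partial>lborel)" .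
    have "(\<integral>\<^sup>+z. ?h z * (ennreal (1 / u) * indicator {0<..1} u * indicator {0..w * u} z) \<partial>lborel)
       = (\<integral>\<^sup>+z. (ennreal (1 / u) * indicator {0<..1} u) * (?h z * indicator {0..w * u} z) \<partial>lborel)"
      by (intro nn_integral_cong) (simp add: mult_ac)
    also have "\<dots> = (ennreal (1 / u) * indicator {0<..1} u) * (\<integral>\<^sup>+z. ?h z * indicator {0..w * u} z \<partial>lborel)"
      by (intro nn_integral_cmult) measurable
    also have "\<dots> = (ennreal (1 / u) * ennreal (w * u)) * (\<integral>\<^sup>+v. ennreal (1 - cos (t * w * u * v)) * indicator {0..1} v \<partial>lborel) * indicator {0<..1} u"
      unfolding * by (simp only: mult_ac)
    also have "ennreal (1 / u) * ennreal (w * u) = ennreal w"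
      using True by (simp flip: ennreal_mult')
    finally show ?thesis using True by (simp add: indicator_def mult_ac)
  qed (use that in \<open>auto simp: indicator_def\<close>)
  have "ennreal w * ennreal (1 - psi (t * w))
      = (\<integral>\<^sup>+u. ennreal w * ((\<integral>\<^sup>+v. ennreal (1 - cos (t * w * u * v)) * indicator {0..1} v \<partial>lborel) * indicator {0..1} u) \<partial>lborel)"
    using assms by (subst one_minus_psi_eq_nn_integral) (auto intro!: nn_integral_cmult[symmetric])
  also have "\<dots> = (\<integral>\<^sup>+u. (\<integral>\<^sup>+z. ?h z * (ennreal (1 / u) * indicator {0<..1} u * indicator {0..w * u} z) \<partial>lborel) \<partial>lborel)"
    using AE_lborel_singleton[of 0] by (intro nn_integral_cong_AE) (auto simp: inner)
  also have "\<dots> = (\<integral>\<^sup>+z. (\<integral>\<^sup>+u. ?h z * (ennreal (1 / u) * indicator {0<..1} u * indicator {0..w * u} z) \<partial>lborel) \<partial>lborel)"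
    unfolding atLeastAtMost_iff indicator_def by (intro lborel_pair.Fubini') measurable
  also have "\<dots> = (\<integral>\<^sup>+z. ?h z * ennreal (ln (w / z)) * indicator {0<..} z \<partial>lborel)"
  proof (rule nn_integral_cong_AE, use AE_lborel_singleton[of 0] in eventually_elim)
    fix z :: real assume "z \<noteq> 0"
    have "(\<integral>\<^sup>+u. ennreal (1 / u) * indicator {0<..1} u * indicator {0..w * u} z \<partial>lborel) = ennreal (ln (w / z)) * indicator {0<..} z"
    proof (cases "0 < z")
      case True
      \<comment> \<open>For fixed \<open>z\<close> the variable \<open>u\<close> runs from
        \<open>z / w\<close> to 1, and integrating \<open>1 / u\<close> yields the
        logarithm.\<close>
      have ind: "indicator {0<..1} u * indicator {0..w * u} z = (indicator {z / w..1} u :: ennreal)" for u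
      proof -
        have "z \<le> w * u \<Longrightarrow> 0 < u" using True assms(2) by (metis less_le_trans zero_less_mult_pos)
        moreover have "z \<le> w * u \<longleftrightarrow> z / w \<le> u" using assms(2) by (simp add: field_simps)
        ultimately show ?thesis using True by (auto simp: indicator_def)
      qed
      show ?thesis
      proof (cases "z \<le> w")
        case le: True
        have pos: "0 < u" if "z / w \<le> u" for u
          using that True assms(2) by (metis divide_pos_pos less_le_trans)
        have "(\<integral>\<^sup>+u. ennreal (1 / u) * indicator {z / w..1} u \<partial>lborel) = ennreal (ln 1 - ln (z / w))"
          using le assms(2) pos by (intro nn_integral_FTC_Icc) (auto intro!: derivative_eq_intros less_imp_le)
        thus ?thesis using True assms(2) by (simp add: ind mult.assoc ln_div)
      next
        case False
        hence "{z / w..1} = {}" using assms(2) by auto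
        \<comment> \<open>Truncation at 0 matches the empty range of integration.\<close>
        moreover have "ln (w / z) \<le> 0" using False True assms(2) by simp
        ultimately show ?thesis by (simp add: ind mult.assoc ennreal_neg)
      qed
    next
      case False
      have ind0: "indicator {0<..1} u * indicator {0..w * u} z = (0 :: ennreal)" for u
        using False \<open>z \<noteq> 0\<close> by (auto simp: indicator_def)
      show ?thesis using False by (simp only: mult.assoc ind0) simp
    qed
    moreover have [measurable]: "(\<lambda>u. indicator {0..w * u} z :: ennreal) \<in> borel_measurable borel"
      unfolding indicator_def atLeastAtMost_iff by measurable
    ultimately show "(\<integral>\<^sup>+u. ?h z * (ennreal (1 / u) * indicator {0<..1} u * indicator {0..w * u} z) \<partial>lborel)
        = ?h z * ennreal (ln (w / z)) * indicator {0<..} z"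
      by (subst nn_integral_cmult) (auto simp: mult.assoc)
  qed
  finally show ?thesis .
qed

text \<open>A variable with the Bessel density is distributed as \<open>W T\<close>, where \<open>T\<close> has characteristic
  function \<open>psi\<close> and \<open>W\<close> is \<open>mix_scale\<close> under \<open>mix_law\<close>, the law of a pair of independent
  Gamma variables of shape \<open>1 + 1 / \<alpha>\<close>.\<close>
definition mix_scale :: "real \<Rightarrow> real \<Rightarrow> real \<times> real \<Rightarrow> real" where
  "mix_scale \<alpha> \<Lambda> p = (fst p * snd p) powr (1 / \<alpha>) / \<Lambda>^2"

definition mix_law :: "real \<Rightarrow> (real \<times> real) measure" where
  "mix_law \<alpha> = density (lborel \<Otimes>\<^sub>M lborel) (\<lambda>p.
     ennreal ((fst p * snd p) powr (1 / \<alpha>) * exp (- (fst p + snd p)) / (Gamma (1 + 1 / \<alpha>))^2)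
     * indicator ({0<..} \<times> {0<..}) p)"

definition bessel_density :: "real \<Rightarrow> real \<Rightarrow> real \<Rightarrow> real" where
  "bessel_density \<alpha> \<Lambda> z = \<alpha> * \<Lambda>^2 / (Gamma (1 / \<alpha>))^2 * bessel_K0 (2 * \<Lambda> powr \<alpha> * \<bar>z\<bar> powr (\<alpha> / 2))"

text \<open>The integrand factors into two Gamma integrals. The exponent \<open>1 / \<alpha>\<close>
  normalizes \<open>mix_law\<close>, and \<open>2 / \<alpha>\<close> yields the mean of
  \<open>mix_scale\<close>.\<close>

lemma nn_integral_gamma_square:
  fixes a :: real
  assumes "0 < a"
  shows "(\<integral>\<^sup>+p. ennreal ((fst p * snd p) powr a * exp (- (fst p + snd p))) * indicator ({0<..} \<times> {0<..}) p \<partial>(lborel \<Otimes>\<^sub>M lborel))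
    = ennreal ((Gamma (1 + a))^2)"
proof -
  let ?g = "\<lambda>s. ennreal (s powr a * exp (- s)) * indicator {0<..} s"
  have G: "(\<integral>\<^sup>+s. ?g s \<partial>lborel) = ennreal (Gamma (1 + a))"
    using assms by (subst Gamma_conv_nn_integral_real)
      (auto intro!: nn_integral_cong simp: indicator_def exp_minus divide_inverse)
  have "(\<integral>\<^sup>+p. ennreal ((fst p * snd p) powr a * exp (- (fst p + snd p))) * indicator ({0<..} \<times> {0<..}) p \<partial>(lborel \<Otimes>\<^sub>M lborel))
      = (\<integral>\<^sup>+s. (\<integral>\<^sup>+r. ?g s * ?g r \<partial>lborel) \<partial>lborel)"
    by (subst lborel.nn_integral_fst[symmetric])
       (auto intro!: nn_integral_cong simp: indicator_def powr_mult exp_diff exp_minus mult_ac divide_inverse simp flip: ennreal_mult')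
  also have "\<dots> = ennreal (Gamma (1 + a)) * ennreal (Gamma (1 + a))"
    by (simp add: nn_integral_cmult nn_integral_multc G)
  also have "\<dots> = ennreal ((Gamma (1 + a))^2)"
    using assms Gamma_real_pos[of "1 + a"] by (simp add: power2_eq_square flip: ennreal_mult')
  finally show ?thesis .
qed

lemma Gamma_one_plus: "0 < a \<Longrightarrow> Gamma (1 + a) = a * Gamma (a::real)"
  using Gamma_plus1[of a] nonpos_Ints_nonpos[of a] by (force simp: add.commute)

lemma prob_space_mix_law:
  assumes "0 < \<alpha>"
  shows "prob_space (mix_law \<alpha>)"
proof (rule prob_spaceI)
  have G: "0 < Gamma (1 + 1 / \<alpha>)" using assms by (intro Gamma_real_pos) (auto intro: add_pos_pos)
  let ?f = "\<lambda>p. ennreal ((fst p * snd p) powr (1 / \<alpha>) * exp (- (fst p + snd p))) * indicator ({0<..} \<times> {0<..}) p"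
  have U: "UNIV \<in> sets (borel \<Otimes>\<^sub>M borel :: (real \<times> real) measure)" by (simp only: borel_prod) simp
  have "emeasure (mix_law \<alpha>) (space (mix_law \<alpha>)) = (\<integral>\<^sup>+p. ennreal (1 / (Gamma (1 + 1 / \<alpha>))^2) * ?f p \<partial>(lborel \<Otimes>\<^sub>M lborel))"
    unfolding mix_law_def by (subst emeasure_density)
      (auto intro!: nn_integral_cong simp: space_pair_measure U simp flip: ennreal_mult' mult.assoc)
  also have "\<dots> = ennreal (1 / (Gamma (1 + 1 / \<alpha>))^2) * ennreal ((Gamma (1 + 1 / \<alpha>))^2)"
    using assms by (subst nn_integral_cmult) (measurable, subst nn_integral_gamma_square, auto)
  also have "\<dots> = 1" using G by (simp flip: ennreal_mult')
  finally show "emeasure (mix_law \<alpha>) (space (mix_law \<alpha>)) = 1" .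
qed

lemma mix_scale_nonneg: "0 \<le> mix_scale \<alpha> \<Lambda> p"
  by (simp add: mix_scale_def)

lemma borel_measurable_mix_scale [measurable]:
  "mix_scale \<alpha> \<Lambda> \<in> borel_measurable (lborel \<Otimes>\<^sub>M lborel)" "mix_scale \<alpha> \<Lambda> \<in> borel_measurable (mix_law \<alpha>')"
  by (simp_all add: mix_scale_def[abs_def] mix_law_def)

text \<open>Weighting by \<open>mix_scale\<close> raises the exponent from
  \<open>1 / \<alpha>\<close> to \<open>2 / \<alpha>\<close>. The functional equation of Gamma then
  produces the factor 4, which will cancel the \<open>1 / 4\<close> of the moment bound.\<close>

lemma mix_scale_expectation:
  assumes "0 < \<alpha>" "0 < \<Lambda>"
  shows "integrable (mix_law \<alpha>) (mix_scale \<alpha> \<Lambda>)"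
    and "(\<integral>p. mix_scale \<alpha> \<Lambda> p \<partial>mix_law \<alpha>) = 4 * (Gamma (2 / \<alpha>))^2 / (\<Lambda>^2 * (Gamma (1 / \<alpha>))^2)"
proof -
  let ?a = "1 / \<alpha>"
  let ?c = "1 / (\<Lambda>^2 * (Gamma (1 + ?a))^2)"
  let ?f = "\<lambda>p. ennreal ((fst p * snd p) powr (2 / \<alpha>) * exp (- (fst p + snd p))) * indicator ({0<..} \<times> {0<..}) p"
  have "(\<integral>\<^sup>+p. ennreal (mix_scale \<alpha> \<Lambda> p) \<partial>mix_law \<alpha>) = (\<integral>\<^sup>+p. ennreal ?c * ?f p \<partial>(lborel \<Otimes>\<^sub>M lborel))"
    unfolding mix_law_def
  proof (subst nn_integral_density)
    show "(\<integral>\<^sup>+p. ennreal ((fst p * snd p) powr ?a * exp (- (fst p + snd p)) / (Gamma (1 + ?a))^2)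
       * indicator ({0<..} \<times> {0<..}) p * ennreal (mix_scale \<alpha> \<Lambda> p) \<partial>(lborel \<Otimes>\<^sub>M lborel)) = (\<integral>\<^sup>+p. ennreal ?c * ?f p \<partial>(lborel \<Otimes>\<^sub>M lborel))"
    proof (rule nn_integral_cong)
      fix p :: "real \<times> real"
      have "(fst p * snd p) powr ?a * exp (- (fst p + snd p)) / (Gamma (1 + ?a))^2 * mix_scale \<alpha> \<Lambda> p
          = ?c * ((fst p * snd p) powr (2 / \<alpha>) * exp (- (fst p + snd p)))"
        using powr_add[of "fst p * snd p" ?a ?a] by (simp add: mix_scale_def field_simps)
      thus "ennreal ((fst p * snd p) powr ?a * exp (- (fst p + snd p)) / (Gamma (1 + ?a))^2)
         * indicator ({0<..} \<times> {0<..}) p * ennreal (mix_scale \<alpha> \<Lambda> p) = ennreal ?c * ?f p"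
        by (auto simp: indicator_def mix_scale_nonneg simp flip: ennreal_mult')
    qed
  qed measurable
  also have "\<dots> = ennreal ?c * ennreal ((Gamma (1 + 2 / \<alpha>))^2)"
    using assms by (subst nn_integral_cmult) (measurable, subst nn_integral_gamma_square, auto)
  also have "\<dots> = ennreal (?c * (Gamma (1 + 2 / \<alpha>))^2)" by (simp flip: ennreal_mult')
  also have "?c * (Gamma (1 + 2 / \<alpha>))^2 = 4 * (Gamma (2 / \<alpha>))^2 / (\<Lambda>^2 * (Gamma ?a)^2)"
  proof -
    have "Gamma (1 + 2 / \<alpha>) = 2 / \<alpha> * Gamma (2 / \<alpha>)" "Gamma (1 + ?a) = ?a * Gamma ?a"
      using assms by (simp_all add: Gamma_one_plus)
    thus ?thesis using assms by (simp only:) (simp add: field_simps)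
  qed
  finally have *: "(\<integral>\<^sup>+p. ennreal (mix_scale \<alpha> \<Lambda> p) \<partial>mix_law \<alpha>) = ennreal (4 * (Gamma (2 / \<alpha>))^2 / (\<Lambda>^2 * (Gamma ?a)^2))" .
  show "integrable (mix_law \<alpha>) (mix_scale \<alpha> \<Lambda>)"
    by (rule integrableI_nonneg) (auto simp: * mix_scale_nonneg)
  show "(\<integral>p. mix_scale \<alpha> \<Lambda> p \<partial>mix_law \<alpha>) = 4 * (Gamma (2 / \<alpha>))^2 / (\<Lambda>^2 * (Gamma ?a)^2)"
    by (rule integral_eq_nn_integral[THEN trans]) (auto simp: * mix_scale_nonneg)
qed

lemma bessel_density_nonneg: "0 < \<alpha> \<Longrightarrow> 0 \<le> bessel_density \<alpha> \<Lambda> z"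
  by (simp add: bessel_density_def bessel_K0_nonneg)

lemma bessel_density_even: "bessel_density \<alpha> \<Lambda> (- z) = bessel_density \<alpha> \<Lambda> z"
  by (simp add: bessel_density_def)

text \<open>The Bessel function is replaced by its logarithmic mixture and the integrals are
  exchanged. The integral over \<open>z\<close> becomes \<open>w * (1 - psi (t * w))\<close>, and
  the extra factor \<open>w\<close> turns the exponential weight into the density of
  \<open>mix_law\<close>.\<close>

lemma nn_integral_bessel_density:
  assumes "0 < \<alpha>" "0 < \<Lambda>" "0 \<le> t" and meas: "(\<lambda>z. ennreal (bessel_density \<alpha> \<Lambda> z)) \<in> borel_measurable borel"
  shows "(\<integral>\<^sup>+z. ennreal (bessel_density \<alpha> \<Lambda> z) * ennreal (1 - cos (t * z)) \<partial>lborel)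
    = (\<integral>\<^sup>+p. ennreal (1 - psi (t * mix_scale \<alpha> \<Lambda> p)) \<partial>mix_law \<alpha>)"
proof -
  note meas[measurable]
  have G1: "Gamma (1 + 1 / \<alpha>) = Gamma (1 / \<alpha>) / \<alpha>" using assms by (simp add: Gamma_one_plus)
  define A where "A = \<alpha> * \<Lambda>^2 / (Gamma (1 / \<alpha>))^2"
  have A: "0 \<le> A" using assms by (simp add: A_def)
  let ?e = "\<lambda>p::real \<times> real. ennreal (exp (- (fst p + snd p)))"
  let ?w = "mix_scale \<alpha> \<Lambda>"
  let ?h = "\<lambda>z. ennreal (1 - cos (t * z))"
  let ?D = "\<lambda>p. ennreal (A * \<alpha>) * ?e p * indicator ({0<..} \<times> {0<..}) p"
  let ?k = "\<lambda>z p. ?h z * ennreal (ln (?w p / z)) * indicator {0<..} z"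
  interpret L: pair_sigma_finite "lborel \<Otimes>\<^sub>M lborel :: (real \<times> real) measure" "lborel :: real measure"
    unfolding lborel_prod by unfold_locales
  have K0: "2 * ennreal (bessel_density \<alpha> \<Lambda> z) = (\<integral>\<^sup>+p. ?D p * ennreal (ln (?w p / z)) \<partial>(lborel \<Otimes>\<^sub>M lborel))"
    if z: "0 < z" for z
  proof -
    define q where "q = \<Lambda> powr (2 * \<alpha>) * z powr \<alpha>"
    have q: "0 < q" using assms z by (simp add: q_def)
    have sqrt_q: "sqrt q = \<Lambda> powr \<alpha> * \<bar>z\<bar> powr (\<alpha> / 2)"
      using z assms by (simp add: q_def powr_half_sqrt[symmetric] powr_mult powr_powr)
    have "2 * ennreal (bessel_density \<alpha> \<Lambda> z) = ennreal A * (2 * ennreal (bessel_K0 (2 * sqrt q)))"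
      using A by (simp add: bessel_density_def A_def[symmetric] sqrt_q ennreal_mult' mult_ac bessel_K0_nonneg)
    also have "\<dots> = (\<integral>\<^sup>+p. ennreal A * (?e p * ennreal (ln (fst p * snd p / q)) * indicator ({0<..} \<times> {0<..}) p) \<partial>(lborel \<Otimes>\<^sub>M lborel))"
      unfolding bessel_K0_mixture[OF q] by (intro nn_integral_cmult[symmetric]) measurable
    also have "\<dots> = (\<integral>\<^sup>+p. ?D p * ennreal (ln (?w p / z)) \<partial>(lborel \<Otimes>\<^sub>M lborel))"
    proof (rule nn_integral_cong)
      fix p :: "real \<times> real"
      show "ennreal A * (?e p * ennreal (ln (fst p * snd p / q)) * indicator ({0<..} \<times> {0<..}) p) = ?D p * ennreal (ln (?w p / z))"
      proof (cases "0 < fst p \<and> 0 < snd p")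
        case True
        \<comment> \<open>The scale is chosen so that \<open>fst p * snd p / q\<close> is the power
          \<open>\<alpha>\<close> of \<open>?w p / z\<close>. As \<open>\<alpha>\<close> is
          positive, truncating the logarithm at 0 commutes with this factor.\<close>
        hence "ln (fst p * snd p / q) = \<alpha> * ln (?w p / z)"
          using z assms by (simp add: q_def mix_scale_def ln_div ln_mult ln_powr field_simps power2_eq_square)
        thus ?thesis using A assms by (simp add: ennreal_mult' mult_ac)
      qed (auto simp: indicator_def)
    qed
    finally show ?thesis .
  qed
  have "(\<integral>\<^sup>+z. ennreal (bessel_density \<alpha> \<Lambda> z) * ?h z \<partial>lborel)
      = 2 * (\<integral>\<^sup>+z. ennreal (bessel_density \<alpha> \<Lambda> z) * ?h z * indicator {0<..} z \<partial>lborel)"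
    by (rule nn_integral_even) (auto simp: bessel_density_even)
  also have "\<dots> = (\<integral>\<^sup>+z. 2 * ennreal (bessel_density \<alpha> \<Lambda> z) * (?h z * indicator {0<..} z) \<partial>lborel)"
    by (subst nn_integral_cmult[symmetric]) (auto simp: mult_ac)
  also have "\<dots> = (\<integral>\<^sup>+z. (\<integral>\<^sup>+p. ?D p * ?k z p \<partial>(lborel \<Otimes>\<^sub>M lborel)) \<partial>lborel)"
  proof (rule nn_integral_cong)
    fix z :: real
    show "2 * ennreal (bessel_density \<alpha> \<Lambda> z) * (?h z * indicator {0<..} z) = (\<integral>\<^sup>+p. ?D p * ?k z p \<partial>(lborel \<Otimes>\<^sub>M lborel))"
    proof (cases "0 < z")
      case True
      have "2 * ennreal (bessel_density \<alpha> \<Lambda> z) * (?h z * indicator {0<..} z)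
          = (\<integral>\<^sup>+p. ?D p * ennreal (ln (?w p / z)) * (?h z * indicator {0<..} z) \<partial>(lborel \<Otimes>\<^sub>M lborel))"
        unfolding K0[OF True] by (intro nn_integral_multc[symmetric]) measurable
      thus ?thesis by (simp add: mult_ac)
    qed simp
  qed
  also have "\<dots> = (\<integral>\<^sup>+p. (\<integral>\<^sup>+z. ?D p * ?k z p \<partial>lborel) \<partial>(lborel \<Otimes>\<^sub>M lborel))"
    by (intro L.Fubini') measurable
  also have "\<dots> = (\<integral>\<^sup>+p. ennreal ((fst p * snd p) powr (1 / \<alpha>) * exp (- (fst p + snd p)) / (Gamma (1 + 1 / \<alpha>))^2)
     * indicator ({0<..} \<times> {0<..}) p * ennreal (1 - psi (t * ?w p)) \<partial>(lborel \<Otimes>\<^sub>M lborel))"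
  proof (rule nn_integral_cong)
    fix p :: "real \<times> real"
    show "(\<integral>\<^sup>+z. ?D p * ?k z p \<partial>lborel) = ennreal ((fst p * snd p) powr (1 / \<alpha>) * exp (- (fst p + snd p)) / (Gamma (1 + 1 / \<alpha>))^2)
     * indicator ({0<..} \<times> {0<..}) p * ennreal (1 - psi (t * ?w p))"
    proof (cases "0 < fst p \<and> 0 < snd p")
      case True
      have w: "0 < ?w p" using True assms by (simp add: mix_scale_def)
      have "(\<integral>\<^sup>+z. ?D p * ?k z p \<partial>lborel) = ?D p * (ennreal (?w p) * ennreal (1 - psi (t * ?w p)))"
        unfolding one_minus_psi_log_density[OF assms(3) w] by (intro nn_integral_cmult) measurable
      moreover have "?D p * ennreal (?w p) = ennreal (A * \<alpha> * exp (- (fst p + snd p)) * ?w p) * indicator ({0<..} \<times> {0<..}) p"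
        using A assms w by (simp add: ennreal_mult' mult_ac)
      \<comment> \<open>By \<open>G1\<close>, \<open>A * \<alpha>\<close> is
        \<open>\<Lambda>^2\<close> divided by the square of \<open>Gamma (1 + 1 / \<alpha>)\<close>;
        the denominator of \<open>mix_scale\<close> cancels \<open>\<Lambda>^2\<close>.\<close>
      moreover have "A * \<alpha> * exp (- (fst p + snd p)) * ?w p
          = (fst p * snd p) powr (1 / \<alpha>) * exp (- (fst p + snd p)) / (Gamma (1 + 1 / \<alpha>))^2"
        using assms unfolding A_def mix_scale_def G1 by (simp add: field_simps power2_eq_square)
      ultimately show ?thesis by (simp only: mult.assoc[symmetric])
    qed (auto simp: indicator_def)
  qed
  also have "\<dots> = (\<integral>\<^sup>+p. ennreal (1 - psi (t * ?w p)) \<partial>mix_law \<alpha>)"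
    unfolding mix_law_def by (subst nn_integral_density) auto
  finally show ?thesis .
qed

text \<open>The real part comes from the mixture identity for \<open>1 - cos\<close>, since both
  laws have total mass 1. The imaginary part vanishes because the density is even.\<close>

lemma (in prob_space) char_bessel_density:
  assumes "0 < \<alpha>" "0 < \<Lambda>" "0 \<le> t" and X: "distributed M lborel X (\<lambda>z. ennreal (bessel_density \<alpha> \<Lambda> z))"
  shows "char (distr M borel X) t = complex_of_real (\<integral>p. psi (t * mix_scale \<alpha> \<Lambda> p) \<partial>mix_law \<alpha>)"
proof -
  interpret P: prob_space "mix_law \<alpha>" using assms by (intro prob_space_mix_law)
  have Xm [measurable]: "X \<in> borel_measurable M" using distributed_measurable[OF X] by simp
  have int_cos: "integrable M (\<lambda>\<omega>. cos (t * X \<omega>))"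
    by (rule integrable_const_bound[where B=1]) auto
  have int_psi: "integrable (mix_law \<alpha>) (\<lambda>p. psi (t * mix_scale \<alpha> \<Lambda> p))"
    using psi_pos psi_le_1 assms(3) mix_scale_nonneg
    by (intro P.integrable_const_bound[where B=1]) (auto simp: abs_of_pos)
  have "ennreal (expectation (\<lambda>\<omega>. 1 - cos (t * X \<omega>))) = (\<integral>\<^sup>+\<omega>. ennreal (1 - cos (t * X \<omega>)) \<partial>M)"
    using int_cos by (intro nn_integral_eq_integral[symmetric]) auto
  also have "\<dots> = (\<integral>\<^sup>+z. ennreal (bessel_density \<alpha> \<Lambda> z) * ennreal (1 - cos (t * z)) \<partial>lborel)"
    by (rule distributed_nn_integral[OF X, symmetric]) auto
  also have "\<dots> = (\<integral>\<^sup>+p. ennreal (1 - psi (t * mix_scale \<alpha> \<Lambda> p)) \<partial>mix_law \<alpha>)"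
    using distributed_borel_measurable[OF X] by (intro nn_integral_bessel_density assms) auto
  also have "\<dots> = ennreal (P.expectation (\<lambda>p. 1 - psi (t * mix_scale \<alpha> \<Lambda> p)))"
    using int_psi psi_le_1 assms(3) mix_scale_nonneg by (intro nn_integral_eq_integral) auto
  finally have "expectation (\<lambda>\<omega>. 1 - cos (t * X \<omega>)) = P.expectation (\<lambda>p. 1 - psi (t * mix_scale \<alpha> \<Lambda> p))"
    using psi_le_1 assms(3) mix_scale_nonneg by (subst (asm) ennreal_inj) (auto intro!: integral_nonneg_AE)
  hence cos: "expectation (\<lambda>\<omega>. cos (t * X \<omega>)) = P.expectation (\<lambda>p. psi (t * mix_scale \<alpha> \<Lambda> p))"
    using int_cos int_psi by (simp add: prob_space P.prob_space)
  have "expectation (\<lambda>\<omega>. sin (t * X \<omega>)) = (\<integral>z. bessel_density \<alpha> \<Lambda> z * sin (t * z) \<partial>lborel)"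
    using assms(1) by (intro distributed_integral[OF X, symmetric]) (auto simp: bessel_density_nonneg)
  \<comment> \<open>Reflection of \<open>z\<close> shows that the sine integral equals its own
    negative.\<close>
  moreover have "(\<integral>z. bessel_density \<alpha> \<Lambda> z * sin (t * z) \<partial>lborel) = - (\<integral>z. bessel_density \<alpha> \<Lambda> z * sin (t * z) \<partial>lborel)"
    by (subst lborel_integral_real_affine[where c="-1" and t=0]) (auto simp: bessel_density_even)
  ultimately have sin: "expectation (\<lambda>\<omega>. sin (t * X \<omega>)) = 0" by simp
  have int: "integrable M (\<lambda>\<omega>. iexp (t * X \<omega>))" by (rule integrable_iexp) measurable
  have "char (distr M borel X) t = (CLINT \<omega>|M. iexp (t * X \<omega>))"
    unfolding char_def by (simp add: integral_distr)
  moreover have "Re (CLINT \<omega>|M. iexp (t * X \<omega>)) = expectation (\<lambda>\<omega>. cos (t * X \<omega>))"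
    by (subst integral_Re[OF int, symmetric]) (simp only: cis_conv_exp[symmetric] cis.sel)
  moreover have "Im (CLINT \<omega>|M. iexp (t * X \<omega>)) = expectation (\<lambda>\<omega>. sin (t * X \<omega>))"
    by (subst integral_Im[OF int, symmetric]) (simp only: cis_conv_exp[symmetric] cis.sel)
  ultimately show ?thesis using cos sin by (simp add: complex_eq_iff)
qed

theorem theorem8:
  fixes M :: "'a measure" and X :: "nat \<Rightarrow> 'a \<Rightarrow> real"
    and \<sigma> \<alpha> \<Lambda> :: real and n :: nat
  assumes "prob_space M"
    and "\<sigma> > 0" and "\<alpha> > 0"
    and \<Lambda>_def: "\<Lambda> = (1 / \<sigma>) * sqrt (Gamma (3 / \<alpha>) / Gamma (1 / \<alpha>))"
    and indep: "prob_space.indep_vars M (\<lambda>_. borel) X {1..}"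
    and dens: "\<And>i. i \<ge> 1 \<Longrightarrow> distributed M lborel (X i)
        (\<lambda>z. ennreal (\<alpha> * \<Lambda>\<^sup>2 / (Gamma (1 / \<alpha>))\<^sup>2
                      * bessel_K0 (2 * \<Lambda> powr \<alpha> * \<bar>z\<bar> powr (\<alpha> / 2))))"
    and integ: "\<And>i. i \<ge> 1 \<Longrightarrow> integrable M (X i)"
    and mean0: "\<And>i. i \<ge> 1 \<Longrightarrow> prob_space.expectation M (X i) = 0"
    and "n \<ge> 1"
  shows "prob_space.expectation M (\<lambda>\<omega>. \<bar>\<Sum>i=1..n. X i \<omega>\<bar>)
           \<ge> sqrt (real n) * (Gamma (2 / \<alpha>))\<^sup>2 / (\<Lambda>\<^sup>2 * (Gamma (1 / \<alpha>))\<^sup>2)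
       \<and> sqrt (real n) * (Gamma (2 / \<alpha>))\<^sup>2 / (\<Lambda>\<^sup>2 * (Gamma (1 / \<alpha>))\<^sup>2)
           = sqrt (real n) * \<sigma>\<^sup>2 * (Gamma (2 / \<alpha>))\<^sup>2 / (Gamma (1 / \<alpha>) * Gamma (3 / \<alpha>))"
proof
  interpret M: prob_space M by fact
  have G: "0 < Gamma (1 / \<alpha>)" "0 < Gamma (3 / \<alpha>)" using \<open>\<alpha> > 0\<close> by (simp_all add: Gamma_real_pos)
  have \<Lambda>: "0 < \<Lambda>" using G \<open>\<sigma> > 0\<close> by (simp add: \<Lambda>_def)
  have dens': "distributed M lborel (X i) (\<lambda>z. ennreal (bessel_density \<alpha> \<Lambda> z))" if "i \<in> {1..n}" for i
    using dens[of i] that by (simp add: bessel_density_def)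
  have "sqrt (card {1..n}) / 4 * (\<integral>p. mix_scale \<alpha> \<Lambda> p \<partial>mix_law \<alpha>) \<le> M.expectation (\<lambda>\<omega>. \<bar>\<Sum>i\<in>{1..n}. X i \<omega>\<bar>)"
  proof (rule expectation_abs_sum_mixture_ge)
    show "M.indep_vars (\<lambda>_. borel) X {1..n}" by (rule M.indep_vars_subset[OF indep]) auto
    show "char (distr M borel (X i)) t = complex_of_real (\<integral>p. psi (t * mix_scale \<alpha> \<Lambda> p) \<partial>mix_law \<alpha>)"
      if "i \<in> {1..n}" "0 < t" for i t
      using that \<Lambda> \<open>\<alpha> > 0\<close> by (intro M.char_bessel_density dens') auto
  qed (use assms \<Lambda> in \<open>auto intro: prob_space_mix_law mix_scale_expectation mix_scale_nonneg\<close>)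
  \<comment> \<open>The 4 in the mean of \<open>mix_scale\<close> cancels the
    \<open>1 / 4\<close>.\<close>
  thus "sqrt (real n) * (Gamma (2 / \<alpha>))\<^sup>2 / (\<Lambda>\<^sup>2 * (Gamma (1 / \<alpha>))\<^sup>2) \<le> M.expectation (\<lambda>\<omega>. \<bar>\<Sum>i=1..n. X i \<omega>\<bar>)"
    using \<Lambda> \<open>\<alpha> > 0\<close> by (simp add: mix_scale_expectation(2))
  have "\<Lambda>\<^sup>2 = Gamma (3 / \<alpha>) / (\<sigma>\<^sup>2 * Gamma (1 / \<alpha>))"
    using G by (simp add: \<Lambda>_def power_mult_distrib power_divide)
  hence *: "\<Lambda>\<^sup>2 * (Gamma (1 / \<alpha>))\<^sup>2 = Gamma (1 / \<alpha>) * Gamma (3 / \<alpha>) / \<sigma>\<^sup>2"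
    using G by (simp add: power2_eq_square)
  show "sqrt (real n) * (Gamma (2 / \<alpha>))\<^sup>2 / (\<Lambda>\<^sup>2 * (Gamma (1 / \<alpha>))\<^sup>2)
      = sqrt (real n) * \<sigma>\<^sup>2 * (Gamma (2 / \<alpha>))\<^sup>2 / (Gamma (1 / \<alpha>) * Gamma (3 / \<alpha>))"
    unfolding * by simp
qed

end
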